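(* There is an absolute constant $C$ such that the following holds. Let $v_0\in\mathbb{R}^n$ be a unit vector, $\epsilon>0$, $\tau\ge C n^{3/4}(\log n)^{1/4}/\epsilon$, and $\mathbf{A}$ an $n\times n\times n$ tensor with independent $\mathcal{N}(0,1)$ entries; let $\mathbf{T}=\tau v_0^{\otimes 3}+\mathbf{A}$ with slices $(T_i)_{jk}=\mathbf{T}_{ijk}$. Let $w\in\mathbb{R}^{n^2}$ be the flattening of $\mathrm{Id}_{n\times n}$, let $v'$ be a top (left or right) singular vector of $M=\sum_i T_i\otimes T_i-n\,ww^T$, let $V'\in\mathbb{R}^{n\times n}$ be its folding $V'_{jk}=v'_{(j,k)}$, and let $v$ be a unit top singular vector of $V'$. Then with probability $1-O(n^{-10})$, $\langle v,v_0\rangle^2\ge 1-O(\epsilon)$.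
   Context: $(A\otimes B)[(j,k),(j',k')]=A_{jj'}B_{kk'}$; $n\,ww^T=\mathbb{E}\sum_iA_i\otimes A_i$ for the Gaussian slices $A_i$. *)

theory Defs
  imports "HOL-Probability.Probability"
begin

(* Vectors are functions 'i => real, only meaningful on a finite index set J.
   Matrices are functions 'i => 'j => real (row index, column index). *)

definition vnorm :: "'j set \<Rightarrow> ('j \<Rightarrow> real) \<Rightarrow> real" where
  "vnorm J x = sqrt (\<Sum>j\<in>J. (x j)\<^sup>2)"

definition mat_vec :: "'i set \<Rightarrow> 'j set \<Rightarrow> ('i \<Rightarrow> 'j \<Rightarrow> real) \<Rightarrow> ('j \<Rightarrow> real) \<Rightarrow> ('i \<Rightarrow> real)" where
  "mat_vec I J A x = (\<lambda>i. \<Sum>j\<in>J. A i j * x j)"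

definition transp_mat :: "('i \<Rightarrow> 'j \<Rightarrow> real) \<Rightarrow> ('j \<Rightarrow> 'i \<Rightarrow> real)" where
  "transp_mat A = (\<lambda>j i. A i j)"

(* top right singular vector of the I x J matrix A: a unit vector x (in R^J)
   maximizing ||A x|| over unit vectors, i.e. a right singular vector for
   the largest singular value *)
definition top_right_sv :: "'i set \<Rightarrow> 'j set \<Rightarrow> ('i \<Rightarrow> 'j \<Rightarrow> real) \<Rightarrow> ('j \<Rightarrow> real) \<Rightarrow> bool" where
  "top_right_sv I J A x \<longleftrightarrow> vnorm J x = 1 \<and>
     (\<forall>y. vnorm J y = 1 \<longrightarrow> vnorm I (mat_vec I J A y) \<le> vnorm I (mat_vec I J A x))"

definition top_left_sv :: "'i set \<Rightarrow> 'j set \<Rightarrow> ('i \<Rightarrow> 'j \<Rightarrow> real) \<Rightarrow> ('i \<Rightarrow> real) \<Rightarrow> bool" where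
  "top_left_sv I J A y \<longleftrightarrow> top_right_sv J I (transp_mat A) y"

definition top_sv :: "'i set \<Rightarrow> ('i \<Rightarrow> 'i \<Rightarrow> real) \<Rightarrow> ('i \<Rightarrow> real) \<Rightarrow> bool" where
  "top_sv I A x \<longleftrightarrow> top_right_sv I I A x \<or> top_left_sv I I A x"

definition kron :: "('a \<Rightarrow> 'a \<Rightarrow> real) \<Rightarrow> ('b \<Rightarrow> 'b \<Rightarrow> real) \<Rightarrow> ('a \<times> 'b \<Rightarrow> 'a \<times> 'b \<Rightarrow> real)" where
  "kron A B = (\<lambda>(j,k) (j',k'). A j j' * B k k')"

definition spiked :: "real \<Rightarrow> (nat \<Rightarrow> real) \<Rightarrow> (nat \<times> nat \<times> nat \<Rightarrow> real) \<Rightarrow> (nat \<times> nat \<times> nat \<Rightarrow> real)" where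
  "spiked \<tau> v0 A = (\<lambda>(i,j,k). \<tau> * v0 i * v0 j * v0 k + A (i,j,k))"

definition slice :: "(nat \<times> nat \<times> nat \<Rightarrow> real) \<Rightarrow> nat \<Rightarrow> nat \<Rightarrow> nat \<Rightarrow> real" where
  "slice T i = (\<lambda>j k. T (i,j,k))"

definition flat_id :: "nat \<times> nat \<Rightarrow> real" where
  "flat_id = (\<lambda>(j,k). if j = k then 1 else 0)"

definition spectral_mat :: "nat \<Rightarrow> (nat \<times> nat \<times> nat \<Rightarrow> real) \<Rightarrow> (nat \<times> nat \<Rightarrow> nat \<times> nat \<Rightarrow> real)" where
  "spectral_mat n T = (\<lambda>p q. (\<Sum>i<n. kron (slice T i) (slice T i) p q) - real n * flat_id p * flat_id q)"

definition fold_vec :: "(nat \<times> nat \<Rightarrow> real) \<Rightarrow> nat \<Rightarrow> nat \<Rightarrow> real" where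
  "fold_vec v' = (\<lambda>j k. v' (j,k))"

definition gauss_tensor :: "nat \<Rightarrow> (nat \<times> nat \<times> nat \<Rightarrow> real) measure" where
  "gauss_tensor n = PiM ({..<n} \<times> {..<n} \<times> {..<n}) (\<lambda>_. density lborel std_normal_density)"

end

(* Write M = tau^2 u u^T + cross + N with u = v0 (x) v0, cross = tau (P (x) G + G (x) P),
   P = v0 v0^T, G = sum_i v0_i A_i and N = sum_i A_i (x) A_i - n w w^T. Once ||cross + N|| is at
   most eta tau^2, maximality of the singular vectors gives |<v', u>| >= 1 - 2 eta and then
   <v, v0>^2 >= 1 - 256 eta.

   ||G||, and each ||A_i||, is O(sqrt n) by a lattice net, the Gaussian tail and a union bound.

   For N, let N' be an independent copy. A fixed bilinear form y^T N' x is O(sqrt n) with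
   probability at least 1/2 by Chebyshev, so it is enough to bound the norm of N - N'.
   Exchanging the i-th slices of the two copies preserves the measure, so N - N' may be replaced
   by sum_i s_i C_i with random signs s_i and ||C_i|| = O(n). Expanding tr (X X^T)^p for
   X = sum_i s_i C_i, the mean of every word in the signs is 0 or 1 and the word in the C_i is at
   most the product of their norms, hence the mean trace is at most
   dim * E (sum_i s_i ||C_i||)^(2p), a scalar Khintchine moment. Taking p of order log n
   gives ||N|| = O(n^(3/2) (log n)^(1/2)) with the required probability. *)

theory Submission
  imports Defs
begin

section \<open>Bilinear forms, operator bounds and perturbed singular vectors\<close>

text \<open>The square of n^(3/4) (log n)^(1/4) is the order of the bound on ||N||, so N dictates
  the threshold on \<tau>; the cross term, of order \<tau> sqrt n, would allow a smaller one. A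
  union bound over a net does not reach this order for N: its forms are quadratic in Gaussians, and
  for y = x = e_1 (x) e_1 the tail at level n^(3/2) is only about exp(-c n^(3/2)), whereas a net of
  the sphere in R^(n^2) has exp(c n^2) points. A trace moment pays only for the dimension n^2, which
  the choice of p reduces to a constant. Bounding words by products of norms puts sum_i ||C_i||^2 in
  place of a matrix variance; with n terms of norm O(n) this is O(n^3), already the right order.
  Quadratic forms are compared with traces by iterated Cauchy-Schwarz, which is why p is a power of
  two.\<close>

definition bil :: "'i set \<Rightarrow> 'j set \<Rightarrow> ('i \<Rightarrow> 'j \<Rightarrow> real) \<Rightarrow> ('i \<Rightarrow> real) \<Rightarrow> ('j \<Rightarrow> real) \<Rightarrow> real" where
  "bil I J A y x = (\<Sum>i\<in>I. \<Sum>j\<in>J. y i * A i j * x j)"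

text \<open>\<open>c\<close> is an upper bound for the spectral norm. A one-sided inequality is
  enough because y may be replaced by -y, and working with upper bounds avoids a supremum.\<close>

definition op_bound :: "'i set \<Rightarrow> 'j set \<Rightarrow> ('i \<Rightarrow> 'j \<Rightarrow> real) \<Rightarrow> real \<Rightarrow> bool" where
  "op_bound I J A c \<longleftrightarrow> 0 \<le> c \<and> (\<forall>y x. bil I J A y x \<le> c * vnorm I y * vnorm J x)"

lemma vnorm_eq_L2_set: "vnorm J x = L2_set x J"
  by (simp add: vnorm_def L2_set_def)

lemma vnorm_nonneg [simp]: "0 \<le> vnorm J x"
  by (simp add: vnorm_def sum_nonneg)

lemma vnorm_power2: "(vnorm J x)\<^sup>2 = (\<Sum>j\<in>J. (x j)\<^sup>2)"
  by (simp add: vnorm_def sum_nonneg)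

lemma vnorm_cong: "(\<And>j. j \<in> J \<Longrightarrow> x j = y j) \<Longrightarrow> vnorm J x = vnorm J y"
  by (simp add: vnorm_def)

lemma vnorm_scale: "vnorm J (\<lambda>j. a * x j) = \<bar>a\<bar> * vnorm J x"
  by (simp add: vnorm_def power_mult_distrib real_sqrt_mult flip: sum_distrib_left)

lemma vnorm_uminus [simp]: "vnorm J (\<lambda>j. - x j) = vnorm J x"
  by (simp add: vnorm_def)

lemma vnorm_triangle: "vnorm J (\<lambda>j. x j + y j) \<le> vnorm J x + vnorm J y"
  unfolding vnorm_eq_L2_set by (rule L2_set_triangle_ineq)

lemma vnorm_sum_le:
  assumes "finite K"
  shows "vnorm J (\<lambda>j. \<Sum>k\<in>K. x k j) \<le> (\<Sum>k\<in>K. vnorm J (x k))"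
  using assms
proof (induction K rule: finite_induct)
  case empty
  then show ?case by (simp add: vnorm_def)
next
  case (insert k K)
  then show ?case using vnorm_triangle[of J "x k" "\<lambda>j. \<Sum>k\<in>K. x k j"] by simp
qed

lemma cauchy_schwarz_sum: "(\<Sum>j\<in>J. x j * y j) \<le> vnorm J x * vnorm J y"
proof -
  have "(\<Sum>j\<in>J. x j * y j) \<le> (\<Sum>j\<in>J. \<bar>x j\<bar> * \<bar>y j\<bar>)"
    by (intro sum_mono) (metis abs_ge_self abs_mult)
  also have "\<dots> \<le> vnorm J x * vnorm J y"
    unfolding vnorm_eq_L2_set by (rule L2_set_mult_ineq)
  finally show ?thesis .
qed

lemma cauchy_schwarz_sum_abs: "\<bar>\<Sum>j\<in>J. x j * y j\<bar> \<le> vnorm J x * vnorm J y"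
  using cauchy_schwarz_sum[of x y J] cauchy_schwarz_sum[of "\<lambda>j. - x j" y J]
  by (simp add: sum_negf)

lemma cauchy_schwarz_power2:
  fixes x y :: "'j \<Rightarrow> real"
  shows "(\<Sum>j\<in>J. x j * y j)\<^sup>2 \<le> (\<Sum>j\<in>J. (x j)\<^sup>2) * (\<Sum>j\<in>J. (y j)\<^sup>2)"
proof -
  have "(\<Sum>j\<in>J. x j * y j)\<^sup>2 \<le> (vnorm J x * vnorm J y)\<^sup>2"
    using cauchy_schwarz_sum_abs[of x y J] abs_le_square_iff by fastforce
  then show ?thesis by (simp add: power_mult_distrib vnorm_power2)
qed

lemma bil_mat_vec: "bil I J A y x = (\<Sum>i\<in>I. y i * mat_vec I J A x i)"
  by (simp add: bil_def mat_vec_def sum_distrib_left mult.assoc)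

lemma bil_transp: "bil J I (transp_mat A) x y = bil I J A y x"
  unfolding bil_def transp_mat_def by (subst sum.swap) (simp add: mult.commute mult.left_commute)

lemma bil_mat_vec_transp: "bil I J A y x = (\<Sum>j\<in>J. mat_vec J I (transp_mat A) y j * x j)"
  by (subst bil_transp[symmetric]) (simp add: bil_mat_vec mult.commute)

lemma op_bound_transp: "op_bound I J A c \<Longrightarrow> op_bound J I (transp_mat A) c"
  unfolding op_bound_def by (simp add: bil_transp mult.commute mult.left_commute)

lemma op_boundD: "op_bound I J A c \<Longrightarrow> bil I J A y x \<le> c * vnorm I y * vnorm J x"
  by (simp add: op_bound_def)

text \<open>Testing the form at y = A x gives ||A x||^2 \<le> c ||A x|| ||x||, and a nonzero factor
  ||A x|| cancels.\<close>

lemma op_bound_vnorm: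
  assumes "op_bound I J A c"
  shows "vnorm I (mat_vec I J A x) \<le> c * vnorm J x"
proof -
  let ?N = "vnorm I (mat_vec I J A x)"
  have "?N\<^sup>2 \<le> c * ?N * vnorm J x"
    using op_boundD[OF assms, of "mat_vec I J A x" x]
    unfolding bil_mat_vec vnorm_power2 by (simp add: power2_eq_square)
  then have le: "?N * ?N \<le> ?N * (c * vnorm J x)"
    by (simp add: power2_eq_square algebra_simps)
  show ?thesis
  proof (cases "?N = 0")
    case False
    then have "?N > 0" using vnorm_nonneg[of I "mat_vec I J A x"] by linarith
    then show ?thesis using le by simp
  next
    case True
    then show ?thesis using assms by (simp add: op_bound_def)
  qed
qed

lemma op_boundI_vnorm:
  assumes "0 \<le> c" "\<And>x. vnorm I (mat_vec I J A x) \<le> c * vnorm J x"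
  shows "op_bound I J A c"
  unfolding op_bound_def
proof (intro conjI allI)
  fix y x
  have "bil I J A y x \<le> vnorm I y * vnorm I (mat_vec I J A x)"
    unfolding bil_mat_vec by (rule cauchy_schwarz_sum)
  also have "\<dots> \<le> vnorm I y * (c * vnorm J x)"
    by (intro mult_left_mono assms) simp
  finally show "bil I J A y x \<le> c * vnorm I y * vnorm J x" by (simp add: algebra_simps)
qed (use assms in auto)

lemma bil_add_mat: "bil I J (\<lambda>i j. A i j + B i j) y x = bil I J A y x + bil I J B y x"
  by (simp add: bil_def sum.distrib algebra_simps)

lemma bil_scale_mat: "bil I J (\<lambda>i j. a * A i j) y x = a * bil I J A y x"
  by (simp add: bil_def sum_distrib_left algebra_simps)

lemma bil_uminus_left: "bil I J A (\<lambda>i. - y i) x = - bil I J A y x"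
  by (simp add: bil_def sum_negf)

lemma bil_scale_left: "bil I J A (\<lambda>i. a * y i) x = a * bil I J A y x"
  by (simp add: bil_def sum_distrib_left algebra_simps)

lemma bil_scale_right: "bil I J A y (\<lambda>j. a * x j) = a * bil I J A y x"
  by (simp add: bil_def sum_distrib_left algebra_simps)

lemma bil_diff_left: "bil I J A (\<lambda>i. y i - y' i) x = bil I J A y x - bil I J A y' x"
  by (simp add: bil_def sum_subtractf algebra_simps)

lemma bil_diff_right: "bil I J A y (\<lambda>j. x j - x' j) = bil I J A y x - bil I J A y x'"
  by (simp add: bil_def sum_subtractf algebra_simps)

lemma bil_cong: "(\<And>i j. i \<in> I \<Longrightarrow> j \<in> J \<Longrightarrow> A i j = B i j) \<Longrightarrow> bil I J A y x = bil I J B y x"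
  by (simp add: bil_def)

lemma op_bound_mono: "op_bound I J A c \<Longrightarrow> c \<le> d \<Longrightarrow> op_bound I J A d"
  unfolding op_bound_def by (meson mult_right_mono order_trans vnorm_nonneg)

lemma op_bound_add:
  assumes "op_bound I J A a" "op_bound I J B b"
  shows "op_bound I J (\<lambda>i j. A i j + B i j) (a + b)"
  using assms unfolding op_bound_def bil_add_mat
  by (auto simp: distrib_right intro!: add_mono)

lemma op_bound_scale:
  assumes "op_bound I J A a"
  shows "op_bound I J (\<lambda>i j. s * A i j) (\<bar>s\<bar> * a)"
  unfolding op_bound_def bil_scale_mat
proof (intro conjI allI)
  fix y x
  have "bil I J A y x \<le> a * vnorm I y * vnorm J x" "- bil I J A y x \<le> a * vnorm I y * vnorm J x"
    using op_boundD[OF assms, of y x] op_boundD[OF assms, of "\<lambda>i. - y i" x]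
    by (simp_all add: bil_uminus_left)
  then have "\<bar>s\<bar> * \<bar>bil I J A y x\<bar> \<le> \<bar>s\<bar> * (a * vnorm I y * vnorm J x)"
    by (intro mult_left_mono) auto
  then show "s * bil I J A y x \<le> \<bar>s\<bar> * a * vnorm I y * vnorm J x"
    by (simp add: abs_mult[symmetric] mult.assoc)
qed (use assms in \<open>simp add: op_bound_def\<close>)

lemma op_bound_diff:
  assumes "op_bound I J A a" "op_bound I J B b"
  shows "op_bound I J (\<lambda>i j. A i j - B i j) (a + b)"
  using op_bound_add[OF assms(1) op_bound_scale[OF assms(2), of "-1"]] by simp

text \<open>Read x as an I by K array: A (x) B applies B along each row and then A along each
  column, so the squared norms can be summed one direction at a time.\<close>

lemma op_bound_kron:
  fixes I :: "'a set" and K :: "'b set"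
  assumes A: "op_bound I I A a" and B: "op_bound K K B b" and fin: "finite I" "finite K"
  shows "op_bound (I \<times> K) (I \<times> K) (kron A B) (a * b)"
proof (rule op_boundI_vnorm)
  have ab: "0 \<le> a" "0 \<le> b" using A B unfolding op_bound_def by blast+
  then show "0 \<le> a * b" by simp
  fix x :: "'a \<times> 'b \<Rightarrow> real"
  define Z where "Z = (\<lambda>j. mat_vec K K B (\<lambda>k. x (j, k)))"
  have eq: "mat_vec (I \<times> K) (I \<times> K) (kron A B) x (j, k) = mat_vec I I A (\<lambda>j'. Z j' k) j" for j k
    by (simp add: mat_vec_def kron_def Z_def sum.cartesian_product' sum_distrib_left mult.assoc)
  have sqA: "(vnorm I (mat_vec I I A x'))\<^sup>2 \<le> a\<^sup>2 * (vnorm I x')\<^sup>2" for x'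
    using power_mono[OF op_bound_vnorm[OF A, of x'], of 2] by (simp add: power_mult_distrib)
  have sqB: "(vnorm K (mat_vec K K B x'))\<^sup>2 \<le> b\<^sup>2 * (vnorm K x')\<^sup>2" for x'
    using power_mono[OF op_bound_vnorm[OF B, of x'], of 2] by (simp add: power_mult_distrib)
  have "(vnorm (I \<times> K) (mat_vec (I \<times> K) (I \<times> K) (kron A B) x))\<^sup>2
      = (\<Sum>j\<in>I. \<Sum>k\<in>K. (mat_vec I I A (\<lambda>j'. Z j' k) j)\<^sup>2)"
    unfolding vnorm_power2 sum.cartesian_product' by (simp add: eq)
  also have "\<dots> = (\<Sum>k\<in>K. (vnorm I (mat_vec I I A (\<lambda>j'. Z j' k)))\<^sup>2)"
    by (subst sum.swap) (simp add: vnorm_power2)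
  also have "\<dots> \<le> (\<Sum>k\<in>K. a\<^sup>2 * (\<Sum>j\<in>I. (Z j k)\<^sup>2))"
    using sqA by (intro sum_mono) (simp add: vnorm_power2)
  also have "\<dots> = a\<^sup>2 * (\<Sum>j\<in>I. (vnorm K (Z j))\<^sup>2)"
    by (simp add: vnorm_power2 sum_distrib_left) (rule sum.swap)
  also have "\<dots> \<le> a\<^sup>2 * (\<Sum>j\<in>I. b\<^sup>2 * (vnorm K (\<lambda>k. x (j, k)))\<^sup>2)"
    using sqB by (intro mult_left_mono sum_mono) (auto simp: Z_def)
  also have "\<dots> = (a * b * vnorm (I \<times> K) x)\<^sup>2"
    by (simp add: vnorm_power2 power_mult_distrib sum_distrib_left sum.cartesian_product' mult.assoc)
  finally show "vnorm (I \<times> K) (mat_vec (I \<times> K) (I \<times> K) (kron A B) x) \<le> a * b * vnorm (I \<times> K) x"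
    by (rule power2_le_imp_le) (use ab in simp)
qed

section \<open>Perturbation of top singular vectors\<close>

text \<open>Maximality of v is compared with the competitor u: T - \<eta> T \<le> ||M u|| \<le> ||M
  v|| \<le> T |<v, u>| + \<eta> T.\<close>

lemma top_right_sv_rank_one:
  assumes E: "op_bound D D E (\<eta> * T)" and T: "T > 0" and u: "vnorm D u = 1"
    and M: "\<And>p q. p \<in> D \<Longrightarrow> q \<in> D \<Longrightarrow> M p q = T * u p * u q + E p q"
    and v: "top_right_sv D D M v"
  shows "\<bar>\<Sum>p\<in>D. v p * u p\<bar> \<ge> 1 - 2 * \<eta>"
proof -
  let ?s = "\<lambda>x. \<Sum>p\<in>D. x p * u p"
  have Mx: "mat_vec D D M x p = (T * ?s x) * u p + mat_vec D D E x p" if "p \<in> D" for x p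
    using that by (simp add: mat_vec_def M sum.distrib sum_distrib_left algebra_simps)
  have Ex: "vnorm D (mat_vec D D E x) \<le> \<eta> * T" if "vnorm D x = 1" for x
    using op_bound_vnorm[OF E, of x] that by simp
  have v1: "vnorm D v = 1" using v unfolding top_right_sv_def by blast
  have uu: "?s u = 1" using vnorm_power2[of D u] u by (simp add: power2_eq_square)
  have "T = vnorm D (\<lambda>p. T * u p)" using u T by (simp add: vnorm_scale)
  also have "\<dots> = vnorm D (\<lambda>p. mat_vec D D M u p + - mat_vec D D E u p)"
    by (intro vnorm_cong) (simp add: Mx uu)
  also have "\<dots> \<le> vnorm D (mat_vec D D M u) + vnorm D (mat_vec D D E u)"
    using vnorm_triangle[of D "mat_vec D D M u" "\<lambda>p. - mat_vec D D E u p"] by simp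
  also have "vnorm D (mat_vec D D M u) \<le> vnorm D (mat_vec D D M v)"
    using v u by (simp add: top_right_sv_def)
  also have "vnorm D (mat_vec D D M v) = vnorm D (\<lambda>p. (T * ?s v) * u p + mat_vec D D E v p)"
    by (intro vnorm_cong) (simp add: Mx)
  also have "\<dots> \<le> vnorm D (\<lambda>p. (T * ?s v) * u p) + vnorm D (mat_vec D D E v)"
    by (rule vnorm_triangle)
  also have "vnorm D (\<lambda>p. (T * ?s v) * u p) = T * \<bar>?s v\<bar>"
    using u T by (simp only: vnorm_scale) (simp add: abs_mult)
  finally have "T \<le> T * \<bar>?s v\<bar> + vnorm D (mat_vec D D E v) + vnorm D (mat_vec D D E u)" by simp
  also have "\<dots> \<le> T * \<bar>?s v\<bar> + \<eta> * T + \<eta> * T"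
    using Ex[OF u] Ex[OF v1] by linarith
  finally have "T * (1 - 2 * \<eta>) \<le> T * \<bar>?s v\<bar>" by (simp add: algebra_simps)
  then show ?thesis using T by simp
qed

text \<open>The spike u u^T is symmetric, so a left vector of M is a right vector of a matrix of the
  same shape, with E transposed.\<close>

lemma top_sv_rank_one:
  assumes E: "op_bound D D E (\<eta> * T)" and T: "T > 0" and u: "vnorm D u = 1"
    and M: "\<And>p q. p \<in> D \<Longrightarrow> q \<in> D \<Longrightarrow> M p q = T * u p * u q + E p q"
    and v: "top_sv D M v"
  shows "\<bar>\<Sum>p\<in>D. v p * u p\<bar> \<ge> 1 - 2 * \<eta>"
  using v unfolding top_sv_def top_left_sv_def
proof
  assume "top_right_sv D D M v"
  then show ?thesis using top_right_sv_rank_one[OF E T u M] by blast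
next
  assume "top_right_sv D D (transp_mat M) v"
  moreover have "transp_mat M p q = T * u p * u q + transp_mat E p q" if "p \<in> D" "q \<in> D" for p q
    using M that by (simp add: transp_mat_def)
  ultimately show ?thesis using top_right_sv_rank_one[OF op_bound_transp[OF E] T u] by blast
qed

lemma mat_vec_frobenius:
  "(vnorm I (mat_vec I J A x))\<^sup>2 \<le> (\<Sum>i\<in>I. \<Sum>j\<in>J. (A i j)\<^sup>2) * (vnorm J x)\<^sup>2"
proof -
  have "(vnorm I (mat_vec I J A x))\<^sup>2 \<le> (\<Sum>i\<in>I. (\<Sum>j\<in>J. (A i j)\<^sup>2) * (vnorm J x)\<^sup>2)"
    unfolding vnorm_power2 mat_vec_def by (intro sum_mono cauchy_schwarz_power2)
  then show ?thesis by (simp add: sum_distrib_right)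
qed

text \<open>With v = \<alpha> u + r, the loss 1 - \<alpha>^2 = ||r||^2 must be linear in \<eta>.
  This works because ||A r|| is at most 2 sqrt \<eta> ||r||, with the factor ||r|| kept; maximality
  of v then gives ||r||^2 \<le> 4 ||A r||, hence ||r|| = O(sqrt \<eta>).\<close>

lemma top_right_sv_aligned:
  assumes fin: "finite J" and fr: "(\<Sum>i\<in>I. \<Sum>j\<in>J. (A i j)\<^sup>2) = 1" and u: "vnorm J u = 1"
    and near: "vnorm I (mat_vec I J A u) \<ge> 1 - 2 * \<eta>" and \<eta>: "0 \<le> \<eta>" "\<eta> \<le> 1/16"
    and v: "top_right_sv I J A v"
  shows "(\<Sum>j\<in>J. v j * u j)\<^sup>2 \<ge> 1 - 256 * \<eta>"
proof -
  define \<alpha> where "\<alpha> = (\<Sum>j\<in>J. v j * u j)"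
  define r where "r = (\<lambda>j. v j - \<alpha> * u j)"
  define Au where "Au = mat_vec I J A u"
  \<comment> \<open>\<open>R\<close> removes the action of A on u. As r is orthogonal to u, A r = R
    r, and the Frobenius normalisation of A leaves only 1 - ||A u||^2 for R.\<close>
  define R where "R = (\<lambda>i j. A i j - Au i * u j)"
  define N where "N = vnorm I Au"
  have uu: "(\<Sum>j\<in>J. (u j)\<^sup>2) = 1" using u vnorm_power2[of J u] by simp
  have v1: "vnorm J v = 1" using v unfolding top_right_sv_def by blast
  have vv: "(\<Sum>j\<in>J. (v j)\<^sup>2) = 1" using v1 vnorm_power2[of J v] by simp
  have ru: "(\<Sum>j\<in>J. u j * r j) = 0"
  proof -
    have "(\<Sum>j\<in>J. u j * r j) = (\<Sum>j\<in>J. v j * u j) - \<alpha> * (\<Sum>j\<in>J. (u j)\<^sup>2)"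
      by (simp add: r_def power2_eq_square algebra_simps sum_subtractf sum_distrib_left)
    then show ?thesis using uu by (simp add: \<alpha>_def)
  qed
  have rr: "(vnorm J r)\<^sup>2 = 1 - \<alpha>\<^sup>2"
  proof -
    have "(vnorm J r)\<^sup>2 = (\<Sum>j\<in>J. (v j)\<^sup>2) - 2 * \<alpha> * (\<Sum>j\<in>J. v j * u j) + \<alpha>\<^sup>2 * (\<Sum>j\<in>J. (u j)\<^sup>2)"
      unfolding vnorm_power2 r_def
      by (simp add: power2_eq_square algebra_simps sum.distrib sum_subtractf sum_distrib_left)
    then show ?thesis using uu vv by (simp add: \<alpha>_def[symmetric] power2_eq_square)
  qed
  have frR: "(\<Sum>i\<in>I. \<Sum>j\<in>J. (R i j)\<^sup>2) = 1 - N\<^sup>2"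
  proof -
    have "(\<Sum>j\<in>J. (R i j)\<^sup>2) = (\<Sum>j\<in>J. (A i j)\<^sup>2) - (Au i)\<^sup>2" for i
    proof -
      have "(\<Sum>j\<in>J. (R i j)\<^sup>2)
        = (\<Sum>j\<in>J. (A i j)\<^sup>2) - 2 * Au i * (\<Sum>j\<in>J. A i j * u j) + (Au i)\<^sup>2 * (\<Sum>j\<in>J. (u j)\<^sup>2)"
        unfolding R_def
        by (simp add: power2_eq_square algebra_simps sum.distrib sum_subtractf sum_distrib_left)
      then show ?thesis using uu by (simp add: Au_def mat_vec_def power2_eq_square)
    qed
    then show ?thesis by (simp add: sum_subtractf fr N_def vnorm_power2)
  qed
  have N1: "N\<^sup>2 \<le> 1"
    using mat_vec_frobenius[of I J A u] fr u by (simp add: N_def Au_def)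
  have N0: "N \<ge> 0" by (simp add: N_def)
  have Nlow: "N\<^sup>2 \<ge> 1 - 4 * \<eta>"
  proof -
    have "N\<^sup>2 \<ge> (1 - 2 * \<eta>)\<^sup>2" using near \<eta> by (intro power_mono) (auto simp: N_def Au_def)
    then show ?thesis using \<eta> by (simp add: power2_eq_square algebra_simps)
      (smt (verit) mult_nonneg_nonneg)
  qed
  define w where "w = mat_vec I J A r"
  have w: "w i = mat_vec I J R r i" for i
  proof -
    have "mat_vec I J R r i = mat_vec I J A r i - Au i * (\<Sum>j\<in>J. u j * r j)"
      by (simp add: R_def mat_vec_def sum_subtractf sum_distrib_left algebra_simps)
    then show ?thesis by (simp add: ru w_def)
  qed
  define W where "W = vnorm I w"
  define b where "b = vnorm J r"
  have W0: "W \<ge> 0" and b0: "b \<ge> 0" by (simp_all add: W_def b_def)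
  have "W\<^sup>2 \<le> (1 - N\<^sup>2) * b\<^sup>2"
    using mat_vec_frobenius[of I J R r] frR w by (simp add: W_def b_def cong: vnorm_cong)
  also have "\<dots> \<le> 4 * \<eta> * b\<^sup>2" using Nlow by (intro mult_right_mono) auto
  finally have W2: "W\<^sup>2 \<le> 4 * \<eta> * b\<^sup>2" .
  have Av: "mat_vec I J A v i = \<alpha> * Au i + w i" for i
    by (simp add: w_def Au_def r_def mat_vec_def sum_subtractf sum_distrib_left algebra_simps)
  have "N \<le> vnorm I (mat_vec I J A v)"
    using v u by (simp add: top_right_sv_def N_def Au_def)
  also have "\<dots> \<le> vnorm I (\<lambda>i. \<alpha> * Au i + w i)" using Av by (simp cong: vnorm_cong)
  also have "\<dots> \<le> \<bar>\<alpha>\<bar> * N + W"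
    using vnorm_triangle[of I "\<lambda>i. \<alpha> * Au i" w] by (simp add: vnorm_scale N_def W_def)
  finally have "N\<^sup>2 \<le> (vnorm I (mat_vec I J A v))\<^sup>2"
    using v u N0 by (auto simp: top_right_sv_def N_def Au_def intro!: power_mono)
  also have "\<dots> = \<alpha>\<^sup>2 * N\<^sup>2 + 2 * \<alpha> * (\<Sum>i\<in>I. Au i * w i) + W\<^sup>2"
    unfolding N_def W_def vnorm_power2 Av
    by (simp add: power2_eq_square algebra_simps sum.distrib sum_distrib_left)
  finally have low: "N\<^sup>2 \<le> \<alpha>\<^sup>2 * N\<^sup>2 + 2 * \<alpha> * (\<Sum>i\<in>I. Au i * w i) + W\<^sup>2" .
  have "\<alpha> * (\<Sum>i\<in>I. Au i * w i) \<le> W"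
  proof -
    have a1: "\<bar>\<alpha>\<bar> \<le> 1" using cauchy_schwarz_sum_abs[of v u J] v1 u by (simp add: \<alpha>_def)
    have n1: "N \<le> 1" using power2_le_imp_le[of N 1] N1 by simp
    have "\<alpha> * (\<Sum>i\<in>I. Au i * w i) \<le> \<bar>\<alpha>\<bar> * \<bar>\<Sum>i\<in>I. Au i * w i\<bar>" by (metis abs_ge_self abs_mult)
    also have "\<dots> \<le> 1 * (N * W)"
      using a1 cauchy_schwarz_sum_abs[of Au w I] by (intro mult_mono) (auto simp: N_def W_def)
    also have "\<dots> \<le> W" using n1 W0 N0 by (simp add: mult_left_le_one_le)
    finally show ?thesis .
  qed
  then have "N\<^sup>2 \<le> \<alpha>\<^sup>2 * N\<^sup>2 + 2 * W + W\<^sup>2" using low by linarith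
  then have "N\<^sup>2 * b\<^sup>2 \<le> 2 * W + W\<^sup>2"
    unfolding b_def rr by (simp add: algebra_simps)
  moreover have "(3/4) * b\<^sup>2 \<le> N\<^sup>2 * b\<^sup>2" using Nlow \<eta> by (intro mult_right_mono) auto
  moreover have "W\<^sup>2 \<le> b\<^sup>2 / 4" using W2 \<eta> mult_right_mono[of \<eta> "1/16" "b\<^sup>2"] by simp
  ultimately have "b\<^sup>2 \<le> 4 * W" by simp
  then have "(b\<^sup>2)\<^sup>2 \<le> (4 * W)\<^sup>2" by (intro power_mono) auto
  also have "\<dots> \<le> 64 * \<eta> * b\<^sup>2" using W2 by (simp add: power_mult_distrib)
  finally have "b\<^sup>2 * b\<^sup>2 \<le> (64 * \<eta>) * b\<^sup>2" by (simp add: power2_eq_square)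
  then have "b\<^sup>2 \<le> 64 * \<eta>"
    using \<eta> mult_right_le_imp_le[of "b\<^sup>2" "b\<^sup>2" "64 * \<eta>"] by (cases "b = 0") auto
  \<comment> \<open>The argument gives 64 \<eta>; the constant in the statement has room to
    spare.\<close>
  then show ?thesis using rr \<eta> by (simp add: b_def \<alpha>_def)
qed

text \<open>The overlap of v' with u (x) u is the quadratic form u^T V' u, a lower bound for ||V'
  u||, and ||v'|| = 1 is the Frobenius normalisation of V'. Both pass to the transpose, which covers
  left vectors.\<close>

lemma top_sv_fold_aligned:
  assumes u: "vnorm {..<n} u = 1"
    and v': "vnorm ({..<n} \<times> {..<n}) v' = 1"
    and near: "\<bar>\<Sum>p\<in>{..<n} \<times> {..<n}. v' p * (u (fst p) * u (snd p))\<bar> \<ge> 1 - 2 * \<eta>"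
    and \<eta>: "0 \<le> \<eta>" "\<eta> \<le> 1/16"
    and v: "top_sv {..<n} (fold_vec v') v"
  shows "(\<Sum>i<n. v i * u i)\<^sup>2 \<ge> 1 - 256 * \<eta>"
proof -
  have b1: "\<bar>bil {..<n} {..<n} (fold_vec v') u u\<bar> \<ge> 1 - 2 * \<eta>"
    using near by (simp add: bil_def fold_vec_def sum.cartesian_product' algebra_simps)
  have b2: "\<bar>bil {..<n} {..<n} (transp_mat (fold_vec v')) u u\<bar> \<ge> 1 - 2 * \<eta>"
    using b1 by (simp add: bil_transp)
  have *: "\<bar>bil {..<n} {..<n} A u u\<bar> \<le> vnorm {..<n} (mat_vec {..<n} {..<n} A u)" for A
    using cauchy_schwarz_sum_abs[of u "mat_vec {..<n} {..<n} A u" "{..<n}"] u by (simp add: bil_mat_vec)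
  have f1: "(\<Sum>i<n. \<Sum>j<n. (fold_vec v' i j)\<^sup>2) = 1"
    using v' vnorm_power2[of "{..<n} \<times> {..<n}" v'] by (simp add: fold_vec_def sum.cartesian_product')
  have f2: "(\<Sum>i<n. \<Sum>j<n. (transp_mat (fold_vec v') i j)\<^sup>2) = 1"
    using f1 by (subst sum.swap) (simp add: transp_mat_def)
  show ?thesis
    using v unfolding top_sv_def top_left_sv_def
  proof
    assume "top_right_sv {..<n} {..<n} (fold_vec v') v"
    then show ?thesis
      using top_right_sv_aligned[OF _ f1 u order_trans[OF b1 *] \<eta>] by simp
  next
    assume "top_right_sv {..<n} {..<n} (transp_mat (fold_vec v')) v"
    then show ?thesis
      using top_right_sv_aligned[OF _ f2 u order_trans[OF b2 *] \<eta>] by simp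
  qed
qed

section \<open>Lattice nets\<close>

lemma op_boundI_unit:
  assumes "0 \<le> c" and le: "\<And>y x. vnorm I y = 1 \<Longrightarrow> vnorm J x = 1 \<Longrightarrow> bil I J A y x \<le> c"
  shows "op_bound I J A c"
  unfolding op_bound_def
proof (intro conjI allI)
  fix y x
  show "bil I J A y x \<le> c * vnorm I y * vnorm J x"
  proof (cases "vnorm I y = 0 \<or> vnorm J x = 0")
    case True
    then have "\<bar>bil I J A y x\<bar> \<le> 0"
      using cauchy_schwarz_sum_abs[of y "mat_vec I J A x" I]
        cauchy_schwarz_sum_abs[of "mat_vec J I (transp_mat A) y" x J]
      by (auto simp: bil_mat_vec bil_mat_vec_transp[symmetric])
    then show ?thesis using True by auto
  next
    case False
    then have pos: "0 < vnorm I y" "0 < vnorm J x"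
      using vnorm_nonneg[of I y] vnorm_nonneg[of J x] by linarith+
    define y' where "y' = (\<lambda>i. (1 / vnorm I y) * y i)"
    define x' where "x' = (\<lambda>j. (1 / vnorm J x) * x j)"
    have "bil I J A y' x' \<le> c"
      using pos by (intro le) (simp_all only: y'_def x'_def vnorm_scale, simp_all)
    then show ?thesis
      unfolding y'_def x'_def bil_scale_left bil_scale_right using pos by (simp add: field_simps)
  qed
qed (use assms in auto)

text \<open>Rounding the coordinates of a unit vector towards 0 to multiples of \<open>1 / (4 sqrt (card I))\<close> does
  not increase the norm and moves the vector by at most 1/4.\<close>
definition lattice_points :: "'i set \<Rightarrow> ('i \<Rightarrow> int) set" where
  "lattice_points I = {z \<in> I \<rightarrow>\<^sub>E UNIV. (\<Sum>i\<in>I. (z i)\<^sup>2) \<le> 16 * int (card I)}"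

definition lattice_net :: "'i set \<Rightarrow> ('i \<Rightarrow> real) set" where
  "lattice_net I = (\<lambda>z i. of_int (z i) / (4 * sqrt (real (card I)))) ` lattice_points I"

lemma sum_half_power_abs_le: "(\<Sum>k\<in>{- int b..int b}. (1/2::real) ^ nat \<bar>k\<bar>) \<le> 3 - 2 * (1/2) ^ b"
proof (induction b)
  case 0
  then show ?case by simp
next
  case (Suc b)
  have "{- int (Suc b)..int (Suc b)} = insert (- int (Suc b)) (insert (int (Suc b)) {- int b..int b})"
    by auto
  then have "(\<Sum>k\<in>{- int (Suc b)..int (Suc b)}. (1/2::real) ^ nat \<bar>k\<bar>)
      = 2 * (1/2) ^ Suc b + (\<Sum>k\<in>{- int b..int b}. (1/2::real) ^ nat \<bar>k\<bar>)"
    by (simp add: nat_add_distrib)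
  then show ?case using Suc by simp
qed

lemma abs_le_power2_int: "\<bar>k\<bar> \<le> (k::int)\<^sup>2"
  using mult_left_mono[of 1 "\<bar>k\<bar>" "\<bar>k\<bar>"] by (cases "k = 0") (auto simp: power2_eq_square)

text \<open>An integer is at most its own square, hence at most the whole sum of squares. The crude
  box gives finiteness and a summation range for the count below.\<close>

lemma lattice_points_bounded:
  assumes "finite I"
  shows "lattice_points I \<subseteq> I \<rightarrow>\<^sub>E {- int (16 * card I)..int (16 * card I)}"
proof
  fix z assume z: "z \<in> lattice_points I"
  have "\<bar>z i\<bar> \<le> 16 * int (card I)" if "i \<in> I" for i
  proof -
    have "(z i)\<^sup>2 \<le> (\<Sum>i\<in>I. (z i)\<^sup>2)" using assms that by (intro member_le_sum) auto
    then show ?thesis using z abs_le_power2_int[of "z i"] by (simp add: lattice_points_def)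
  qed
  then have "z i \<in> {- int (16 * card I)..int (16 * card I)}" if "i \<in> I" for i
    using that by (force simp: abs_le_iff)
  moreover have "z i = undefined" if "i \<notin> I" for i
    using z that by (auto simp: lattice_points_def dest: PiE_arb)
  ultimately show "z \<in> I \<rightarrow>\<^sub>E {- int (16 * card I)..int (16 * card I)}"
    by (intro PiE_I)
qed

lemma finite_lattice_points:
  assumes "finite I"
  shows "finite (lattice_points I)"
proof -
  have "finite (I \<rightarrow>\<^sub>E {- int (16 * card I)..int (16 * card I)})"
    using assms by (intro finite_PiE) auto
  then show ?thesis using lattice_points_bounded[OF assms] by (rule rev_finite_subset)
qed

lemma card_lattice_points:
  assumes "finite I"
  shows "real (card (lattice_points I)) \<le> 2 ^ (18 * card I)"
proof -
  define m where "m = card I"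
  define B where "B = I \<rightarrow>\<^sub>E {- int (16 * m)..int (16 * m)}"
  have finB: "finite B" unfolding B_def using assms by (intro finite_PiE) auto
  \<comment> \<open>Chernoff-type counting: a weight that is at least 1 on every lattice point and whose sum factorises.\<close>
  have one: "1 \<le> (\<Prod>i\<in>I. (1/2::real) ^ nat \<bar>z i\<bar>) * 2 ^ (16 * m)" if z: "z \<in> lattice_points I" for z
  proof -
    have "(\<Sum>i\<in>I. \<bar>z i\<bar>) \<le> (\<Sum>i\<in>I. (z i)\<^sup>2)" by (intro sum_mono abs_le_power2_int)
    also have "\<dots> \<le> 16 * int m" using z by (simp add: lattice_points_def m_def)
    finally have "int (\<Sum>i\<in>I. nat \<bar>z i\<bar>) \<le> int (16 * m)" by simp
    then have "(\<Sum>i\<in>I. nat \<bar>z i\<bar>) \<le> 16 * m" by (simp only: of_nat_le_iff)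
    then have "(1/2::real) ^ (16 * m) \<le> (1/2) ^ (\<Sum>i\<in>I. nat \<bar>z i\<bar>)"
      by (intro power_decreasing) auto
    also have "\<dots> = (\<Prod>i\<in>I. (1/2::real) ^ nat \<bar>z i\<bar>)" by (rule power_sum)
    finally have "(1/2::real) ^ (16 * m) * 2 ^ (16 * m) \<le> (\<Prod>i\<in>I. (1/2::real) ^ nat \<bar>z i\<bar>) * 2 ^ (16 * m)"
      by (intro mult_right_mono) auto
    then show ?thesis by (simp flip: power_mult_distrib)
  qed
  have "real (card (lattice_points I)) = (\<Sum>z\<in>lattice_points I. 1)" by simp
  also have "\<dots> \<le> (\<Sum>z\<in>lattice_points I. (\<Prod>i\<in>I. (1/2::real) ^ nat \<bar>z i\<bar>) * 2 ^ (16 * m))"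
    by (intro sum_mono one)
  also have "\<dots> \<le> (\<Sum>z\<in>B. (\<Prod>i\<in>I. (1/2::real) ^ nat \<bar>z i\<bar>) * 2 ^ (16 * m))"
    using lattice_points_bounded[OF assms] finB
    by (intro sum_mono2) (auto simp: B_def m_def intro!: mult_nonneg_nonneg prod_nonneg)
  also have "\<dots> = (\<Prod>i\<in>I. \<Sum>k\<in>{- int (16 * m)..int (16 * m)}. (1/2::real) ^ nat \<bar>k\<bar>) * 2 ^ (16 * m)"
    unfolding B_def by (subst prod_sum_PiE) (auto simp: assms sum_distrib_right)
  \<comment> \<open>The two-sided geometric series stays below 3, so every coordinate costs at most
    4 = 2^2; with the weight 2^(16 m) this makes the exponent 18 m.\<close>
  also have "\<dots> \<le> (\<Prod>i\<in>I. 4) * 2 ^ (16 * m)"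
  proof (intro mult_right_mono prod_mono conjI)
    have "0 \<le> (1/2::real) ^ (16 * m)" by simp
    then show "(\<Sum>k\<in>{- int (16 * m)..int (16 * m)}. (1/2::real) ^ nat \<bar>k\<bar>) \<le> 4"
      using sum_half_power_abs_le[of "16 * m"] by linarith
  qed (auto intro: sum_nonneg)
  also have "(\<Prod>i\<in>I. 4::real) = 2 ^ (2 * m)" by (simp add: m_def power_mult)
  also have "2 ^ (2 * m) * 2 ^ (16 * m) = (2::real) ^ (18 * m)" by (simp only: power_add[symmetric]) simp
  finally show ?thesis by (simp add: m_def)
qed

lemma finite_lattice_net: "finite I \<Longrightarrow> finite (lattice_net I)"
  by (simp add: lattice_net_def finite_lattice_points)

lemma card_lattice_net:
  assumes "finite I"
  shows "real (card (lattice_net I)) \<le> 2 ^ (18 * card I)"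
proof -
  have "real (card (lattice_net I)) \<le> real (card (lattice_points I))"
    unfolding lattice_net_def of_nat_le_iff by (rule card_image_le[OF finite_lattice_points[OF assms]])
  then show ?thesis using card_lattice_points[OF assms] by (rule order_trans)
qed

lemma vnorm_lattice_net_le:
  assumes "x \<in> lattice_net I"
  shows "vnorm I x \<le> 1"
proof -
  obtain z where z: "z \<in> lattice_points I" and x: "x = (\<lambda>i. of_int (z i) / (4 * sqrt (real (card I))))"
    using assms by (auto simp: lattice_net_def)
  have "real_of_int (\<Sum>i\<in>I. (z i)\<^sup>2) \<le> real_of_int (16 * int (card I))"
    using z unfolding lattice_points_def of_int_le_iff by blast
  then have "(\<Sum>i\<in>I. (real_of_int (z i))\<^sup>2) / (16 * real (card I)) \<le> 1" by (simp add: divide_le_eq)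
  moreover have "(vnorm I x)\<^sup>2 = (\<Sum>i\<in>I. (real_of_int (z i))\<^sup>2) / (16 * real (card I))"
    by (simp add: vnorm_power2 x power_divide power_mult_distrib sum_divide_distrib)
  ultimately show ?thesis using power2_le_imp_le[of "vnorm I x" 1] by simp
qed

lemma lattice_net_approx:
  assumes "finite I" and x: "vnorm I x = 1"
  shows "\<exists>x'\<in>lattice_net I. vnorm I (\<lambda>i. x i - x' i) \<le> 1/4"
proof -
  define m where "m = real (card I)"
  have "I \<noteq> {}" using x by (auto simp: vnorm_def)
  then have m: "m > 0" using assms by (simp add: m_def card_gt_0_iff)
  define a where "a = 4 * sqrt m"
  have a: "a > 0" "a\<^sup>2 = 16 * m" using m by (simp_all add: a_def power_mult_distrib)
  define z where "z = restrict (\<lambda>i. if x i \<ge> 0 then \<lfloor>a * x i\<rfloor> else \<lceil>a * x i\<rceil>) I"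
  have z1: "\<bar>real_of_int (z i)\<bar> \<le> \<bar>a * x i\<bar>" and z2: "\<bar>a * x i - real_of_int (z i)\<bar> \<le> 1"
    if "i \<in> I" for i
  proof -
    have "\<bar>real_of_int (z i)\<bar> \<le> \<bar>a * x i\<bar> \<and> \<bar>a * x i - real_of_int (z i)\<bar> \<le> 1"
    proof (cases "x i \<ge> 0")
      case True
      then have "0 \<le> a * x i" using a by simp
      moreover from this have "0 \<le> real_of_int \<lfloor>a * x i\<rfloor>" by simp
      moreover have "z i = \<lfloor>a * x i\<rfloor>" using True that by (simp add: z_def)
      ultimately show ?thesis using floor_correct[of "a * x i"] by linarith
    next
      case False
      then have "a * x i \<le> 0" using a by (simp add: mult_le_0_iff)
      moreover from this have "real_of_int \<lceil>a * x i\<rceil> \<le> 0" by simp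
      moreover have "z i = \<lceil>a * x i\<rceil>" using False that by (simp add: z_def)
      ultimately show ?thesis using ceiling_correct[of "a * x i"] by linarith
    qed
    then show "\<bar>real_of_int (z i)\<bar> \<le> \<bar>a * x i\<bar>" "\<bar>a * x i - real_of_int (z i)\<bar> \<le> 1" by auto
  qed
  have xx: "(\<Sum>i\<in>I. (x i)\<^sup>2) = 1" using x vnorm_power2[of I x] by simp
  have "(\<Sum>i\<in>I. (real_of_int (z i))\<^sup>2) \<le> (\<Sum>i\<in>I. (a * x i)\<^sup>2)"
    using z1 by (intro sum_mono) (simp add: abs_le_square_iff)
  also have "\<dots> = 16 * m" using xx a by (simp add: power_mult_distrib flip: sum_distrib_left)
  finally have "real_of_int (\<Sum>i\<in>I. (z i)\<^sup>2) \<le> real_of_int (16 * int (card I))"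
    by (simp add: m_def)
  then have zin: "z \<in> lattice_points I"
    unfolding of_int_le_iff by (simp add: lattice_points_def) (simp add: z_def)
  define x' where "x' = (\<lambda>i. of_int (z i) / (4 * sqrt (real (card I))))"
  have "x i - x' i = (a * x i - real_of_int (z i)) / a" for i
    using a by (simp add: x'_def a_def[symmetric] m_def[symmetric] diff_divide_distrib)
  then have "(vnorm I (\<lambda>i. x i - x' i))\<^sup>2 = (\<Sum>i\<in>I. (a * x i - real_of_int (z i))\<^sup>2 / a\<^sup>2)"
    by (simp add: vnorm_power2 power_divide)
  also have "\<dots> \<le> (\<Sum>i\<in>I. 1 / a\<^sup>2)"
    using z2 by (intro sum_mono divide_right_mono) (auto simp: abs_square_le_1)
  also have "\<dots> = (1/4)\<^sup>2" using m a by (simp add: m_def power2_eq_square)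
  finally have "vnorm I (\<lambda>i. x i - x' i) \<le> 1/4" by (rule power2_le_imp_le) simp
  moreover have "x' \<in> lattice_net I" using zin by (auto simp: lattice_net_def x'_def)
  ultimately show ?thesis by blast
qed

lemma op_bound_frobenius: "op_bound I J A (sqrt (\<Sum>i\<in>I. \<Sum>j\<in>J. (A i j)\<^sup>2))"
proof (rule op_boundI_vnorm)
  fix x
  show "vnorm I (mat_vec I J A x) \<le> sqrt (\<Sum>i\<in>I. \<Sum>j\<in>J. (A i j)\<^sup>2) * vnorm J x"
  proof (rule power2_le_imp_le)
    show "(vnorm I (mat_vec I J A x))\<^sup>2 \<le> (sqrt (\<Sum>i\<in>I. \<Sum>j\<in>J. (A i j)\<^sup>2) * vnorm J x)\<^sup>2"
      using mat_vec_frobenius[of I J A x] by (simp add: power_mult_distrib sum_nonneg)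
  qed (simp add: sum_nonneg)
qed (simp add: sum_nonneg)

text \<open>Moving y and x to net points costs c / 4 each, so any bound c improves to c / 2 + t. The
  fixed point of this map is 2 t, reached in the limit when starting from the Frobenius
  norm.\<close>

lemma op_bound_lattice_net:
  assumes fin: "finite I" "finite J" and t: "0 \<le> t"
    and net: "\<And>y x. y \<in> lattice_net I \<Longrightarrow> x \<in> lattice_net J \<Longrightarrow> bil I J A y x \<le> t"
  shows "op_bound I J A (2 * t)"
proof -
  have step: "op_bound I J A (c / 2 + t)" if c: "op_bound I J A c" for c
  proof (rule op_boundI_unit)
    have c0: "0 \<le> c" using c by (simp add: op_bound_def)
    then show "0 \<le> c / 2 + t" using t by simp
    fix y x assume y: "vnorm I y = 1" and x: "vnorm J x = 1"
    obtain y' where y': "y' \<in> lattice_net I" "vnorm I (\<lambda>i. y i - y' i) \<le> 1/4"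
      using lattice_net_approx[OF fin(1) y] by blast
    obtain x' where x': "x' \<in> lattice_net J" "vnorm J (\<lambda>j. x j - x' j) \<le> 1/4"
      using lattice_net_approx[OF fin(2) x] by blast
    have "bil I J A (\<lambda>i. y i - y' i) x \<le> c * vnorm I (\<lambda>i. y i - y' i) * vnorm J x"
      by (rule op_boundD[OF c])
    also have "\<dots> \<le> c * (1/4)" using y'(2) x c0 by (simp only: mult_1_right) (rule mult_left_mono)
    finally have 1: "bil I J A (\<lambda>i. y i - y' i) x \<le> c / 4" by simp
    have "bil I J A y' (\<lambda>j. x j - x' j) \<le> c * vnorm I y' * vnorm J (\<lambda>j. x j - x' j)"
      by (rule op_boundD[OF c])
    also have "\<dots> \<le> c * 1 * (1/4)"
      using c0 x'(2) vnorm_lattice_net_le[OF y'(1)] by (intro mult_mono mult_nonneg_nonneg) auto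
    finally have 2: "bil I J A y' (\<lambda>j. x j - x' j) \<le> c / 4" by simp
    show "bil I J A y x \<le> c / 2 + t"
      using 1 2 net[OF y'(1) x'(1)] by (simp add: bil_diff_left bil_diff_right)
  qed
  define F where "F = sqrt (\<Sum>i\<in>I. \<Sum>j\<in>J. (A i j)\<^sup>2)"
  have iter: "op_bound I J A (2 * t + F * (1/2) ^ k)" for k
  proof (induction k)
    case 0
    show ?case unfolding F_def by (rule op_bound_mono[OF op_bound_frobenius]) (use t in simp)
  next
    case (Suc k)
    from step[OF Suc] show ?case by (simp add: algebra_simps add_divide_distrib)
  qed
  show ?thesis
    unfolding op_bound_def
  proof (intro conjI allI)
    fix y x
    have "(\<lambda>k. (2 * t + F * (1/2) ^ k) * vnorm I y * vnorm J x) \<longlonglongrightarrow> (2 * t + F * 0) * vnorm I y * vnorm J x"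
      by (intro tendsto_intros LIMSEQ_realpow_zero) auto
    then have "bil I J A y x \<le> (2 * t + F * 0) * vnorm I y * vnorm J x"
      by (rule LIMSEQ_le_const) (use op_boundD[OF iter] in blast)
    then show "bil I J A y x \<le> 2 * t * vnorm I y * vnorm J x" by simp
  qed (use t in simp)
qed

section \<open>Random signs\<close>

definition sign_vectors :: "'i set \<Rightarrow> ('i \<Rightarrow> real) set" where
  "sign_vectors I = I \<rightarrow>\<^sub>E {-1, 1}"

text \<open>Every Walsh coefficient of the vector-valued \<open>F\<close>, indexed by a word \<open>l\<close> in the signs, has norm
  at most the corresponding coefficient of the scalar \<open>g\<close>. Multiplying \<open>F\<close> by a signed matrix sum
  prepends a letter to \<open>l\<close>, so the relation survives matrix products.\<close>
definition dominated :: "'i set \<Rightarrow> 'j set \<Rightarrow> (('i \<Rightarrow> real) \<Rightarrow> 'j \<Rightarrow> real) \<Rightarrow> (('i \<Rightarrow> real) \<Rightarrow> real) \<Rightarrow> bool" where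
  "dominated I J F g \<longleftrightarrow> (\<forall>l. set l \<subseteq> I \<longrightarrow>
     vnorm J (\<lambda>j. \<Sum>s\<in>sign_vectors I. prod_list (map s l) * F s j)
       \<le> (\<Sum>s\<in>sign_vectors I. prod_list (map s l) * g s))"

lemma finite_sign_vectors [simp]: "finite I \<Longrightarrow> finite (sign_vectors I)"
  unfolding sign_vectors_def by (intro finite_PiE) auto

lemma card_sign_vectors: "finite I \<Longrightarrow> card (sign_vectors I) = 2 ^ card I"
  unfolding sign_vectors_def by (simp add: card_PiE numeral_2_eq_2)

text \<open>Grouping a word by its letters makes averages over independent coordinates factor; this
  serves both the signs and the Gaussian moments.\<close>

lemma prod_list_map_eq_prod_count:
  fixes s :: "'i \<Rightarrow> real"
  assumes "finite I" "set l \<subseteq> I"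
  shows "prod_list (map s l) = (\<Prod>i\<in>I. s i ^ count_list l i)"
  using assms(2)
proof (induction l)
  case (Cons a l)
  have "(\<Prod>i\<in>I. s i ^ count_list (a # l) i) = (\<Prod>i\<in>I. (if i = a then s i else 1) * s i ^ count_list l i)"
    by (intro prod.cong) auto
  also have "\<dots> = s a * prod_list (map s l)"
    using Cons assms(1) by (simp add: prod.distrib prod.delta)
  finally show ?case by simp
qed simp

text \<open>The sum factors over coordinates, a letter contributing 0 if it occurs an odd number of
  times and 2 otherwise. This positivity is what starts the domination argument.\<close>

lemma sum_sign_vectors_prod_list_nonneg:
  assumes "finite I" "set l \<subseteq> I"
  shows "0 \<le> (\<Sum>s\<in>sign_vectors I. prod_list (map s l))"
proof -
  have "(\<Sum>s\<in>sign_vectors I. prod_list (map s l)) = (\<Prod>i\<in>I. \<Sum>y\<in>{-1, 1}. y ^ count_list l i)"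
    unfolding sign_vectors_def prod_list_map_eq_prod_count[OF assms]
    by (subst prod_sum_PiE) (auto simp: assms)
  also have "\<dots> \<ge> 0"
    by (intro prod_nonneg) (auto simp: minus_one_power_iff)
  finally show ?thesis .
qed

lemma dominated_const:
  assumes "finite I" "vnorm J e \<le> 1"
  shows "dominated I J (\<lambda>_. e) (\<lambda>_. 1)"
  unfolding dominated_def
proof (intro allI impI)
  fix l assume l: "set l \<subseteq> I"
  let ?S = "\<Sum>s\<in>sign_vectors I. prod_list (map s l)"
  have "vnorm J (\<lambda>j. ?S * e j) \<le> ?S * 1"
    unfolding vnorm_scale
    using sum_sign_vectors_prod_list_nonneg[OF assms(1) l] assms(2) by (intro mult_mono) auto
  then show "vnorm J (\<lambda>j. \<Sum>s\<in>sign_vectors I. prod_list (map s l) * e j)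
      \<le> (\<Sum>s\<in>sign_vectors I. prod_list (map s l) * 1)"
    by (simp add: sum_distrib_right)
qed

text \<open>The coefficient of X F at \<open>l\<close> is the sum over i of C_i applied to the
  coefficient of F at \<open>i # l\<close>. The triangle inequality turns this into the exact
  recursion for the scalar factor sum_i s_i c_i.\<close>

lemma dominated_mat_vec:
  assumes fin: "finite I" "finite J" and C: "\<And>i. i \<in> I \<Longrightarrow> op_bound K J (C i) (c i)" and dom: "dominated I J F g"
  shows "dominated I K (\<lambda>s. mat_vec K J (\<lambda>k j. \<Sum>i\<in>I. s i * C i k j) (F s)) (\<lambda>s. (\<Sum>i\<in>I. s i * c i) * g s)"
  unfolding dominated_def
proof (intro allI impI)
  fix l assume l: "set l \<subseteq> I"
  let ?w = "\<lambda>l s. prod_list (map s l) :: real"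
  define V where "V = (\<lambda>i j. \<Sum>s\<in>sign_vectors I. ?w (i # l) s * F s j)"
  have "(\<Sum>s\<in>sign_vectors I. ?w l s * mat_vec K J (\<lambda>k j. \<Sum>i\<in>I. s i * C i k j) (F s) k)
      = (\<Sum>i\<in>I. mat_vec K J (C i) (V i) k)" for k
  proof -
    have "(\<Sum>s\<in>sign_vectors I. ?w l s * mat_vec K J (\<lambda>k j. \<Sum>i\<in>I. s i * C i k j) (F s) k)
        = (\<Sum>s\<in>sign_vectors I. \<Sum>j\<in>J. \<Sum>i\<in>I. C i k j * (?w (i # l) s * F s j))"
      by (simp add: mat_vec_def sum_distrib_left sum_distrib_right algebra_simps)
    also have "\<dots> = (\<Sum>j\<in>J. \<Sum>i\<in>I. \<Sum>s\<in>sign_vectors I. C i k j * (?w (i # l) s * F s j))"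
      by (subst sum.swap, rule sum.cong[OF refl], rule sum.swap)
    also have "\<dots> = (\<Sum>i\<in>I. \<Sum>j\<in>J. C i k j * V i j)"
      by (subst sum.swap) (simp add: V_def sum_distrib_left)
    finally show ?thesis by (simp add: mat_vec_def)
  qed
  then have "vnorm K (\<lambda>k. \<Sum>s\<in>sign_vectors I. ?w l s * mat_vec K J (\<lambda>k j. \<Sum>i\<in>I. s i * C i k j) (F s) k)
      = vnorm K (\<lambda>k. \<Sum>i\<in>I. mat_vec K J (C i) (V i) k)" by simp
  also have "\<dots> \<le> (\<Sum>i\<in>I. vnorm K (mat_vec K J (C i) (V i)))" by (rule vnorm_sum_le[OF fin(1)])
  also have "\<dots> \<le> (\<Sum>i\<in>I. c i * (\<Sum>s\<in>sign_vectors I. ?w (i # l) s * g s))"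
  proof (rule sum_mono)
    fix i assume i: "i \<in> I"
    have "vnorm K (mat_vec K J (C i) (V i)) \<le> c i * vnorm J (V i)"
      by (rule op_bound_vnorm[OF C[OF i]])
    also have "vnorm J (V i) \<le> (\<Sum>s\<in>sign_vectors I. ?w (i # l) s * g s)"
      using dom[unfolded dominated_def, THEN spec, of "i # l"] l i by (simp add: V_def)
    finally show "vnorm K (mat_vec K J (C i) (V i)) \<le> c i * (\<Sum>s\<in>sign_vectors I. ?w (i # l) s * g s)"
      using C[OF i] by (simp add: op_bound_def mult_left_mono)
  qed
  also have "\<dots> = (\<Sum>s\<in>sign_vectors I. ?w l s * ((\<Sum>i\<in>I. s i * c i) * g s))"
    unfolding sum_distrib_left sum_distrib_right
    by (subst sum.swap) (simp add: algebra_simps)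
  finally show "vnorm K (\<lambda>k. \<Sum>s\<in>sign_vectors I. ?w l s * mat_vec K J (\<lambda>k j. \<Sum>i\<in>I. s i * C i k j) (F s) k)
      \<le> (\<Sum>s\<in>sign_vectors I. ?w l s * ((\<Sum>i\<in>I. s i * c i) * g s))" .
qed

section \<open>Traces of powers of A A^T\<close>

text \<open>This is the operator A A^T; as a map on functions it can be raised to powers by
  iteration with \<open>^^\<close>.\<close>

definition gram :: "'i set \<Rightarrow> 'j set \<Rightarrow> ('i \<Rightarrow> 'j \<Rightarrow> real) \<Rightarrow> ('i \<Rightarrow> real) \<Rightarrow> ('i \<Rightarrow> real)" where
  "gram K J A x = mat_vec K J A (mat_vec J K (transp_mat A) x)"

definition gram_trace :: "'i set \<Rightarrow> 'j set \<Rightarrow> ('i \<Rightarrow> 'j \<Rightarrow> real) \<Rightarrow> nat \<Rightarrow> real" where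
  "gram_trace K J A p = (\<Sum>a\<in>K. (gram K J A ^^ p) (indicator {a}) a)"

lemma gram_bilinear:
  "(\<Sum>k\<in>K. x k * gram K J A y k)
    = (\<Sum>j\<in>J. mat_vec J K (transp_mat A) x j * mat_vec J K (transp_mat A) y j)"
  using bil_mat_vec_transp[of K J A x "mat_vec J K (transp_mat A) y"]
  by (simp add: gram_def bil_mat_vec)

lemma gram_symmetric: "(\<Sum>k\<in>K. x k * gram K J A y k) = (\<Sum>k\<in>K. gram K J A x k * y k)"
  using gram_bilinear[of x K J A y] gram_bilinear[of y K J A x] by (simp add: mult.commute)

lemma gram_funpow_symmetric:
  "(\<Sum>k\<in>K. x k * (gram K J A ^^ m) y k) = (\<Sum>k\<in>K. (gram K J A ^^ m) x k * y k)"
proof (induction m arbitrary: y)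
  case (Suc m)
  have "(\<Sum>k\<in>K. x k * (gram K J A ^^ Suc m) y k) = (\<Sum>k\<in>K. x k * (gram K J A ^^ m) (gram K J A y) k)"
    by (simp only: funpow_Suc_right o_apply)
  then show ?case by (simp add: Suc gram_symmetric)
qed simp

lemma gram_quadratic: "(\<Sum>k\<in>K. y k * gram K J A y k) = (vnorm J (mat_vec J K (transp_mat A) y))\<^sup>2"
  unfolding vnorm_power2 gram_bilinear by (simp add: power2_eq_square)

lemma gram_funpow_double:
  "(\<Sum>k\<in>K. y k * (gram K J A ^^ (2 * q)) y k) = (vnorm K ((gram K J A ^^ q) y))\<^sup>2"
proof -
  have "(\<Sum>k\<in>K. y k * (gram K J A ^^ (2 * q)) y k) = (\<Sum>k\<in>K. y k * (gram K J A ^^ q) ((gram K J A ^^ q) y) k)"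
    by (simp add: mult_2 funpow_add)
  also have "\<dots> = (\<Sum>k\<in>K. (gram K J A ^^ q) y k * (gram K J A ^^ q) y k)"
    by (rule gram_funpow_symmetric)
  finally show ?thesis unfolding vnorm_power2 by (simp only: power2_eq_square)
qed

text \<open>By Cauchy-Schwarz and symmetry, <y, G^q y>^2 \<le> ||y||^2 ||G^q y||^2 \<le> <y, G^(2q)
  y>. Each use doubles q, hence the exponents 2^m.\<close>

lemma gram_quadratic_power_le:
  assumes y: "vnorm K y \<le> 1"
  shows "(\<Sum>k\<in>K. y k * gram K J A y k) ^ (2 ^ m) \<le> (\<Sum>k\<in>K. y k * (gram K J A ^^ (2 ^ m)) y k)"
proof (induction m)
  case (Suc m)
  let ?a = "\<lambda>q. \<Sum>k\<in>K. y k * (gram K J A ^^ q) y k"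
  have nn: "0 \<le> ?a 1 ^ (2 ^ m)" by (intro zero_le_power) (simp add: gram_quadratic)
  have "?a 1 ^ (2 ^ Suc m) = (?a 1 ^ (2 ^ m))\<^sup>2" by (metis power_Suc2 power_mult)
  also have "\<dots> \<le> (?a (2 ^ m))\<^sup>2" using Suc nn by (intro power_mono) simp_all
  also have "\<dots> \<le> (vnorm K y)\<^sup>2 * (vnorm K ((gram K J A ^^ (2 ^ m)) y))\<^sup>2"
    unfolding vnorm_power2 by (rule cauchy_schwarz_power2)
  also have "\<dots> \<le> 1 * (vnorm K ((gram K J A ^^ (2 ^ m)) y))\<^sup>2"
    using y by (intro mult_right_mono) (auto simp: power_le_one)
  also have "\<dots> = ?a (2 ^ Suc m)" by (simp add: gram_funpow_double)
  finally show ?case by simp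
qed simp

lemma gram_funpow_expand:
  assumes "finite K" "k \<in> K"
  shows "(gram K J A ^^ q) y k = (\<Sum>a\<in>K. y a * (gram K J A ^^ q) (indicator {a}) k)"
proof -
  have "(gram K J A ^^ q) y k = (\<Sum>a\<in>K. (gram K J A ^^ q) y a * indicator {k} a)"
    using assms by (simp add: indicator_def of_bool_def if_distrib cong: if_cong)
  also have "\<dots> = (\<Sum>a\<in>K. y a * (gram K J A ^^ q) (indicator {k}) a)"
    by (rule gram_funpow_symmetric[symmetric])
  also have "\<dots> = (\<Sum>a\<in>K. y a * (gram K J A ^^ q) (indicator {a}) k)"
  proof (intro sum.cong refl arg_cong2[where f="(*)"])
    fix a assume "a \<in> K"
    then show "(gram K J A ^^ q) (indicator {k}) a = (gram K J A ^^ q) (indicator {a}) k"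
    using gram_funpow_symmetric[where x="indicator {a}" and y="indicator {k}" and K=K and J=J and A=A and m=q] assms
      by (simp add: indicator_def of_bool_def if_distrib if_distribR cong: if_cong)
  qed
  finally show ?thesis .
qed

lemma gram_trace_double:
  assumes "finite K"
  shows "gram_trace K J A (2 * q) = (\<Sum>a\<in>K. (vnorm K ((gram K J A ^^ q) (indicator {a})))\<^sup>2)"
proof -
  have "(gram K J A ^^ (2 * q)) (indicator {a}) a = (vnorm K ((gram K J A ^^ q) (indicator {a})))\<^sup>2" if "a \<in> K" for a
    using gram_funpow_double[where y="indicator {a}" and K=K and J=J and A=A and q=q] assms that
    by (simp add: indicator_def of_bool_def if_distrib if_distribR cong: if_cong)
  then show ?thesis by (simp add: gram_trace_def)
qed

text \<open>With G = A A^T and q = 2^m, <y, G^(2q) y> = ||G^q y||^2 is at most the squared Frobenius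
  norm of G^q, which equals tr G^(2q). The exponent \<open>Suc m\<close> makes the power even for
  this step.\<close>

lemma bil_power_le_gram_trace:
  assumes fin: "finite K" and y: "vnorm K y \<le> 1" and x: "vnorm J x \<le> 1"
    and t: "0 \<le> t" "t \<le> bil K J A y x"
  shows "t ^ (2 * 2 ^ Suc m) \<le> gram_trace K J A (2 ^ Suc m)"
proof -
  let ?G = "gram K J A"
  have "t \<le> vnorm J (mat_vec J K (transp_mat A) y) * vnorm J x"
    using t(2) cauchy_schwarz_sum[of "mat_vec J K (transp_mat A) y" x J] by (simp add: bil_mat_vec_transp)
  also have "\<dots> \<le> vnorm J (mat_vec J K (transp_mat A) y) * 1"
    using x by (intro mult_left_mono) auto
  finally have "t\<^sup>2 \<le> (\<Sum>k\<in>K. y k * ?G y k)"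
    unfolding gram_quadratic using t by (intro power_mono) auto
  then have "(t\<^sup>2) ^ (2 ^ Suc m) \<le> (\<Sum>k\<in>K. y k * ?G y k) ^ (2 ^ Suc m)"
    by (intro power_mono) auto
  also have "\<dots> \<le> (\<Sum>k\<in>K. y k * (?G ^^ (2 ^ Suc m)) y k)" by (rule gram_quadratic_power_le[OF y])
  also have "\<dots> = (vnorm K ((?G ^^ (2 ^ m)) y))\<^sup>2" by (simp add: gram_funpow_double)
  also have "\<dots> = (\<Sum>k\<in>K. (\<Sum>a\<in>K. y a * (?G ^^ (2 ^ m)) (indicator {a}) k)\<^sup>2)"
    unfolding vnorm_power2 by (intro sum.cong refl arg_cong[where f="\<lambda>z. z\<^sup>2"] gram_funpow_expand[OF fin])
  also have "\<dots> \<le> (\<Sum>k\<in>K. (\<Sum>a\<in>K. (y a)\<^sup>2) * (\<Sum>a\<in>K. ((?G ^^ (2 ^ m)) (indicator {a}) k)\<^sup>2))"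
    by (intro sum_mono cauchy_schwarz_power2)
  also have "\<dots> = (vnorm K y)\<^sup>2 * (\<Sum>k\<in>K. \<Sum>a\<in>K. ((?G ^^ (2 ^ m)) (indicator {a}) k)\<^sup>2)"
    by (simp add: vnorm_power2 sum_distrib_left)
  also have "\<dots> \<le> 1 * (\<Sum>k\<in>K. \<Sum>a\<in>K. ((?G ^^ (2 ^ m)) (indicator {a}) k)\<^sup>2)"
    using y by (intro mult_right_mono) (auto simp: power_le_one sum_nonneg)
  also have "\<dots> = gram_trace K J A (2 * 2 ^ m)"
    unfolding gram_trace_double[OF fin] vnorm_power2 by (subst sum.swap) simp
  finally show ?thesis by (simp add: power_mult)
qed

text \<open>One factor A A^T is two multiplications, by X^T and then by X, so it contributes the
  square of sum_i s_i c_i.\<close>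

lemma dominated_gram_funpow:
  assumes fin: "finite I" "finite J" "finite K" and C: "\<And>i. i \<in> I \<Longrightarrow> op_bound K J (C i) (c i)"
    and e: "vnorm K e \<le> 1"
  shows "dominated I K (\<lambda>s. (gram K J (\<lambda>k j. \<Sum>i\<in>I. s i * C i k j) ^^ p) e) (\<lambda>s. (\<Sum>i\<in>I. s i * c i) ^ (2 * p))"
proof (induction p)
  case 0
  then show ?case using dominated_const[OF fin(1) e] by simp
next
  case (Suc p)
  have T: "transp_mat (\<lambda>k j. \<Sum>i\<in>I. s i * C i k j) = (\<lambda>j k. \<Sum>i\<in>I. s i * transp_mat (C i) j k)" for s
    by (simp add: transp_mat_def)
  show ?case
    using dominated_mat_vec[OF fin(1) fin(2) C dominated_mat_vec[OF fin(1) fin(3) op_bound_transp[OF C] Suc]]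
    by (simp add: gram_def T mult.assoc)
qed

lemma sum_signs_gram_trace_le:
  assumes fin: "finite I" "finite J" "finite K" and C: "\<And>i. i \<in> I \<Longrightarrow> op_bound K J (C i) (c i)"
  shows "(\<Sum>s\<in>sign_vectors I. gram_trace K J (\<lambda>k j. \<Sum>i\<in>I. s i * C i k j) p)
    \<le> card K * (\<Sum>s\<in>sign_vectors I. (\<Sum>i\<in>I. s i * c i) ^ (2 * p))"
proof -
  let ?X = "\<lambda>s k j. \<Sum>i\<in>I. s i * C i k j"
  have "(\<Sum>s\<in>sign_vectors I. (gram K J (?X s) ^^ p) (indicator {a}) a)
      \<le> (\<Sum>s\<in>sign_vectors I. (\<Sum>i\<in>I. s i * c i) ^ (2 * p))" if a: "a \<in> K" for a
  proof -
    let ?v = "\<lambda>k. \<Sum>s\<in>sign_vectors I. (gram K J (?X s) ^^ p) (indicator {a}) k"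
    have "vnorm K (indicator {a}) \<le> 1"
    proof -
      have "(indicator {a} j :: real)\<^sup>2 = (if j = a then 1 else 0)" for j by (simp add: indicator_def)
      then show ?thesis using fin a by (simp add: vnorm_def)
    qed
    \<comment> \<open>The empty word turns domination into a bound on the unweighted sum over the
      signs; a single entry is then at most the norm.\<close>
    from dominated_gram_funpow[OF fin C this, where p=p]
    have "vnorm K ?v \<le> (\<Sum>s\<in>sign_vectors I. (\<Sum>i\<in>I. s i * c i) ^ (2 * p))"
      unfolding dominated_def by (force dest: spec[of _ "[]"])
    moreover have "?v a \<le> vnorm K ?v"
      unfolding vnorm_eq_L2_set by (rule member_le_L2_set) (use fin a in auto)
    ultimately show ?thesis by linarith
  qed
  then have "(\<Sum>a\<in>K. \<Sum>s\<in>sign_vectors I. (gram K J (?X s) ^^ p) (indicator {a}) a)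
      \<le> (\<Sum>a\<in>K. \<Sum>s\<in>sign_vectors I. (\<Sum>i\<in>I. s i * c i) ^ (2 * p))" by (rule sum_mono)
  then show ?thesis
    unfolding gram_trace_def by (subst sum.swap) simp
qed

section \<open>Scalar Khintchine moments\<close>

lemma two_power_fact_le: "2 ^ n * fact n \<le> (fact (2 * n) :: real)"
proof (induction n)
  case (Suc n)
  have "2 ^ Suc n * fact (Suc n) = (2 * real n + 2) * (2 ^ n * fact n :: real)" by (simp add: algebra_simps)
  also have "\<dots> \<le> (2 * real n + 2) * (1 * fact (2 * n))"
    using Suc by (intro mult_left_mono) auto
  also have "\<dots> \<le> (2 * real n + 2) * ((2 * real n + 1) * fact (2 * n))"
    by (intro mult_left_mono mult_right_mono) auto
  also have "\<dots> = fact (2 * Suc n)" by (simp add: algebra_simps)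
  finally show ?case .
qed simp

text \<open>The odd terms of the two series cancel, and the even ones compare termwise because (2n)!
  is at least 2^n n!.\<close>

lemma exp_plus_exp_minus_le: "exp x + exp (- x) \<le> 2 * exp (x\<^sup>2 / 2 :: real)"
proof -
  have exp_sums: "(\<lambda>n. y ^ n / fact n) sums exp y" for y :: real
    using exp_converges[of y] by (simp add: divide_inverse mult.commute)
  have "(\<lambda>n. x ^ n / fact n + (- x) ^ n / fact n) sums (exp x + exp (- x))"
    by (rule sums_add[OF exp_sums exp_sums])
  moreover have "strict_mono (\<lambda>n::nat. 2 * n)" by (simp add: strict_mono_def)
  moreover have "x ^ n / fact n + (- x) ^ n / fact n = 0" if "n \<notin> range (\<lambda>n. 2 * n)" for n
  proof -
    have "odd n" using that by (auto elim: evenE)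
    then show ?thesis by (simp add: power_minus_odd)
  qed
  ultimately have "(\<lambda>n. x ^ (2 * n) / fact (2 * n) + (- x) ^ (2 * n) / fact (2 * n)) sums (exp x + exp (- x))"
    using sums_mono_reindex[of "\<lambda>n. 2 * n" "\<lambda>n. x ^ n / fact n + (- x) ^ n / fact n"] by simp
  moreover have "(\<lambda>n. 2 * ((x\<^sup>2 / 2) ^ n / fact n)) sums (2 * exp (x\<^sup>2 / 2))"
    by (rule sums_mult[OF exp_sums])
  moreover have "x ^ (2 * n) / fact (2 * n) + (- x) ^ (2 * n) / fact (2 * n) \<le> 2 * ((x\<^sup>2 / 2) ^ n / fact n)" for n
  proof -
    have "x ^ (2 * n) / fact (2 * n) \<le> x ^ (2 * n) / (2 ^ n * fact n)"
      using two_power_fact_le[of n] by (intro divide_left_mono) (auto simp: power_mult)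
    then show ?thesis by (simp add: power_mult power_divide)
  qed
  ultimately show ?thesis by (rule sums_le[rotated 1]) 
qed

lemma power_le_fact_exp: "y ^ (2 * p) \<le> fact (2 * p) * (exp y + exp (- y :: real))"
proof -
  have *: "z ^ n / fact n \<le> exp z" if "z \<ge> 0" for z :: real and n
  proof -
    have "(\<Sum>k\<in>{n}. z ^ k /\<^sub>R fact k) \<le> (\<Sum>k. z ^ k /\<^sub>R fact k)"
      using that by (intro sum_le_suminf summable_exp_generic) auto
    then show ?thesis by (simp add: exp_def divide_inverse mult.commute)
  qed
  have "y ^ (2 * p) / fact (2 * p) \<le> exp \<bar>y\<bar>" using *[of "\<bar>y\<bar>" "2 * p"] by (simp add: power_even_abs)
  also have "\<dots> \<le> exp y + exp (- y)" by (cases "y \<ge> 0") auto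
  finally show ?thesis by (simp add: field_simps)
qed

lemma sum_signs_exp_le:
  assumes "finite I" and le: "(\<Sum>i\<in>I. (c i)\<^sup>2) \<le> \<sigma>2"
  shows "(\<Sum>s\<in>sign_vectors I. exp (\<Sum>i\<in>I. s i * c i)) \<le> 2 ^ card I * exp (\<sigma>2 / 2)"
proof -
  have "(\<Sum>s\<in>sign_vectors I. exp (\<Sum>i\<in>I. s i * c i)) = (\<Prod>i\<in>I. \<Sum>y\<in>{-1, 1}. exp (y * c i))"
    unfolding sign_vectors_def by (subst prod_sum_PiE) (auto simp: assms exp_sum)
  also have "\<dots> \<le> (\<Prod>i\<in>I. 2 * exp ((c i)\<^sup>2 / 2))"
    using exp_plus_exp_minus_le by (intro prod_mono) (auto simp: add.commute intro!: add_nonneg_nonneg)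
  also have "\<dots> = 2 ^ card I * exp ((\<Sum>i\<in>I. (c i)\<^sup>2) / 2)"
    by (simp add: prod.distrib exp_sum assms sum_divide_distrib)
  also have "\<dots> \<le> 2 ^ card I * exp (\<sigma>2 / 2)" using le by simp
  finally show ?thesis .
qed

lemma sum_signs_power_le:
  assumes fin: "finite I" and le: "(\<Sum>i\<in>I. (c i)\<^sup>2) \<le> \<sigma>2" and \<sigma>: "\<sigma>2 > 0" and p: "p > 0"
  shows "(\<Sum>s\<in>sign_vectors I. (\<Sum>i\<in>I. s i * c i) ^ (2 * p)) \<le> 2 ^ Suc (card I) * (2 * exp 1 * real p * \<sigma>2) ^ p"
proof -
  \<comment> \<open>This r minimises exp(r^2 \<sigma>2 / 2) / r^(2p). The exponential moment becomes
    e^p, while r^(2p) cancels half of the growth of (2p)!, leaving a single power of p inside the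
    bracket.\<close>
  define r where "r = sqrt (2 * real p / \<sigma>2)"
  have r: "r > 0" "r\<^sup>2 = 2 * real p / \<sigma>2" using p \<sigma> by (auto simp: r_def)
  have "(\<Sum>i\<in>I. (r * c i)\<^sup>2) = 2 * real p / \<sigma>2 * (\<Sum>i\<in>I. (c i)\<^sup>2)"
    by (simp only: power_mult_distrib r(2) sum_distrib_left)
  then have le': "(\<Sum>i\<in>I. (r * c i)\<^sup>2) \<le> 2 * real p" "(\<Sum>i\<in>I. (- r * c i)\<^sup>2) \<le> 2 * real p"
    using mult_left_mono[OF le, of "2 * real p / \<sigma>2"] \<sigma> by simp_all
  have "r ^ (2 * p) * (\<Sum>s\<in>sign_vectors I. (\<Sum>i\<in>I. s i * c i) ^ (2 * p))
      = (\<Sum>s\<in>sign_vectors I. (r * (\<Sum>i\<in>I. s i * c i)) ^ (2 * p))"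
    by (subst sum_distrib_left) (simp only: power_mult_distrib)
  also have "\<dots> \<le> (\<Sum>s\<in>sign_vectors I. fact (2 * p) * (exp (\<Sum>i\<in>I. s i * (r * c i)) + exp (\<Sum>i\<in>I. s i * (- r * c i))))"
    using power_le_fact_exp[of "r * (\<Sum>i\<in>I. s i * c i)" p for s]
    by (intro sum_mono) (simp add: sum_distrib_left sum_negf mult.left_commute)
  also have "\<dots> \<le> fact (2 * p) * (2 ^ card I * exp (2 * real p / 2) + 2 ^ card I * exp (2 * real p / 2))"
    unfolding sum_distrib_left[symmetric] sum.distrib
    using sum_signs_exp_le[OF fin le'(1)] sum_signs_exp_le[OF fin le'(2)]
    by (intro mult_left_mono add_mono) auto
  also have "\<dots> = 2 ^ Suc (card I) * exp 1 ^ p * fact (2 * p)"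
    by (simp add: exp_of_nat_mult[symmetric])
  also have "\<dots> \<le> 2 ^ Suc (card I) * exp 1 ^ p * (2 * real p) ^ (2 * p)"
    using fact_le_power[of "2 * p", where 'a=real] by (intro mult_left_mono) auto
  finally have "(\<Sum>s\<in>sign_vectors I. (\<Sum>i\<in>I. s i * c i) ^ (2 * p))
      \<le> 2 ^ Suc (card I) * exp 1 ^ p * (2 * real p) ^ (2 * p) / r ^ (2 * p)"
    using r by (simp add: pos_le_divide_eq mult.commute)
  also have "\<dots> = 2 ^ Suc (card I) * (exp 1 * (2 * real p)\<^sup>2 / (2 * real p / \<sigma>2)) ^ p"
    by (simp only: power_mult r(2) power_divide power_mult_distrib)  simp
  also have "exp 1 * (2 * real p)\<^sup>2 / (2 * real p / \<sigma>2) = 2 * exp 1 * real p * \<sigma>2"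
    using p \<sigma> by (simp add: power2_eq_square field_simps)
  finally show ?thesis .
qed

section \<open>Gaussian tails\<close>

lemma product_prob_space_std_normal: "product_prob_space (\<lambda>_. std_normal_distribution)"
  by (rule product_prob_spaceI) (rule prob_space_normal_density, simp)

lemma prob_space_PiM_std_normal: "prob_space (PiM K (\<lambda>_. std_normal_distribution))"
  by (intro prob_space_PiM prob_space_normal_density) simp

lemma integral_PiM_std_normal_prod:
  fixes f :: "'k \<Rightarrow> real \<Rightarrow> real"
  assumes "finite K" "\<And>i. i \<in> K \<Longrightarrow> integrable std_normal_distribution (f i)"
  shows "integrable (PiM K (\<lambda>_. std_normal_distribution)) (\<lambda>x. \<Prod>i\<in>K. f i (x i))"
    and "(LINT x|PiM K (\<lambda>_. std_normal_distribution). (\<Prod>i\<in>K. f i (x i))) = (\<Prod>i\<in>K. LINT t|std_normal_distribution. f i t)"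
proof -
  interpret product_prob_space "\<lambda>_::'k. std_normal_distribution" by (rule product_prob_space_std_normal)
  show "integrable (PiM K (\<lambda>_. std_normal_distribution)) (\<lambda>x. \<Prod>i\<in>K. f i (x i))"
    by (rule product_integrable_prod[OF assms])
  show "(LINT x|PiM K (\<lambda>_. std_normal_distribution). (\<Prod>i\<in>K. f i (x i))) = (\<Prod>i\<in>K. LINT t|std_normal_distribution. f i t)"
    by (rule product_integral_prod[OF assms])
qed

text \<open>Completing the square turns the weight exp(r t) into a shift of the density to mean r,
  up to the factor exp(r^2 / 2).\<close>

lemma std_normal_mgf:
  "integrable std_normal_distribution (\<lambda>t. exp (r * t))"
  "(LINT t|std_normal_distribution. exp (r * t)) = exp (r\<^sup>2 / 2)"
proof -
  have eq: "std_normal_density t * exp (r * t) = exp (r\<^sup>2 / 2) * normal_density r 1 t" for t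
  proof -
    have "- t\<^sup>2 / 2 + r * t = r\<^sup>2 / 2 + - (t - r)\<^sup>2 / 2" by (simp add: power2_eq_square field_simps)
    then show ?thesis
      by (simp add: normal_density_def mult.left_commute flip: exp_add)
  qed
  have int: "integrable lborel (\<lambda>t. std_normal_density t * exp (r * t))"
    unfolding eq by simp
  then show "integrable std_normal_distribution (\<lambda>t. exp (r * t))"
    by (subst integrable_density) auto
  have "(LINT t|std_normal_distribution. exp (r * t)) = (\<integral>t. std_normal_density t * exp (r * t) \<partial>lborel)"
    by (subst integral_density) auto
  then show "(LINT t|std_normal_distribution. exp (r * t)) = exp (r\<^sup>2 / 2)"
    unfolding eq by simp
qed

text \<open>Chernoff bound whose parameter is the level t itself, the minimiser of exp(r^2 / 2 - r
  t).\<close>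

lemma std_normal_linear_tail:
  fixes c :: "'k \<Rightarrow> real"
  assumes K: "finite K" and c: "(\<Sum>a\<in>K. (c a)\<^sup>2) \<le> 1" and t: "0 \<le> t"
  defines "G \<equiv> PiM K (\<lambda>_. std_normal_distribution)"
  shows "measure G {x \<in> space G. (\<Sum>a\<in>K. c a * x a) \<ge> t} \<le> exp (- t\<^sup>2 / 2)"
proof -
  have e: "(\<Prod>a\<in>K. exp (t * c a * x a)) = exp (t * (\<Sum>a\<in>K. c a * x a))" for x
    by (simp add: exp_sum[OF K, symmetric] sum_distrib_left mult.assoc)
  note P = integral_PiM_std_normal_prod[OF K std_normal_mgf(1), where r1="\<lambda>a. t * c a", folded G_def]
  have int: "integrable G (\<lambda>x. exp (t * (\<Sum>a\<in>K. c a * x a)))" using P(1) by (simp add: e)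
  have "(LINT x|G. exp (t * (\<Sum>a\<in>K. c a * x a))) = exp (t\<^sup>2 / 2 * (\<Sum>a\<in>K. (c a)\<^sup>2))"
    using P(2) unfolding e std_normal_mgf
    by (simp add: exp_sum[OF K, symmetric] sum_distrib_left power_mult_distrib)
  also have "\<dots> \<le> exp (t\<^sup>2 / 2)" using c by (simp add: mult_left_le)
  finally have mgf: "(LINT x|G. exp (t * (\<Sum>a\<in>K. c a * x a))) \<le> exp (t\<^sup>2 / 2)" .
  interpret prob_space G unfolding G_def by (rule prob_space_PiM_std_normal)
  have "{x \<in> space G. (\<Sum>a\<in>K. c a * x a) \<ge> t} \<subseteq> {x \<in> space G. exp (t * (\<Sum>a\<in>K. c a * x a)) \<ge> exp (t * t)}"
    using t by (auto intro: mult_left_mono)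
  moreover have "{x \<in> space G. exp (t * (\<Sum>a\<in>K. c a * x a)) \<ge> exp (t * t)} \<in> events"
    using borel_measurable_integrable[OF int] by measurable
  ultimately have "measure G {x \<in> space G. (\<Sum>a\<in>K. c a * x a) \<ge> t}
      \<le> measure G {x \<in> space G. exp (t * (\<Sum>a\<in>K. c a * x a)) \<ge> exp (t * t)}"
    by (rule finite_measure_mono)
  also have "\<dots> \<le> (LINT x|G. exp (t * (\<Sum>a\<in>K. c a * x a))) / exp (t * t)"
    by (rule integral_Markov_inequality_measure[OF int sets.empty_sets]) auto
  also have "\<dots> \<le> exp (t\<^sup>2 / 2) / exp (t * t)" using mgf by (intro divide_right_mono) auto
  also have "\<dots> = exp (- t\<^sup>2 / 2)" by (simp add: power2_eq_square flip: exp_diff)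
  finally show ?thesis .
qed

section \<open>Moments of Gaussian quadratic forms\<close>

lemma std_normal_word_moment:
  fixes l :: "'k list"
  assumes K: "finite K" and l: "set l \<subseteq> K"
  shows "integrable (PiM K (\<lambda>_. std_normal_distribution)) (\<lambda>x. prod_list (map x l))"
    and "(LINT x|PiM K (\<lambda>_. std_normal_distribution). prod_list (map x l))
      = (\<Prod>i\<in>set l. LINT t|std_normal_distribution. t ^ count_list l i)"
proof -
  note P = integral_PiM_std_normal_prod[OF K integrable_std_normal_distribution_moment, where k1="\<lambda>i. count_list l i"]
  show "integrable (PiM K (\<lambda>_. std_normal_distribution)) (\<lambda>x. prod_list (map x l))"
    unfolding prod_list_map_eq_prod_count[OF assms] by (rule P(1))
  have "(LINT x|PiM K (\<lambda>_. std_normal_distribution). prod_list (map x l))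
      = (\<Prod>i\<in>K. LINT t|std_normal_distribution. t ^ count_list l i)"
    unfolding prod_list_map_eq_prod_count[OF assms] by (rule P(2))
  also have "\<dots> = (\<Prod>i\<in>set l. LINT t|std_normal_distribution. t ^ count_list l i)"
  proof (rule prod.mono_neutral_right[OF K l], intro ballI)
    fix i assume "i \<in> K - set l"
    then have "count_list l i = 0" by simp
    then show "(LINT t|std_normal_distribution. t ^ count_list l i) = 1"
      using std_normal_distribution_even_moments(1)[of 0] by simp
  qed
  finally show "(LINT x|PiM K (\<lambda>_. std_normal_distribution). prod_list (map x l))
      = (\<Prod>i\<in>set l. LINT t|std_normal_distribution. t ^ count_list l i)" .
qed

lemma std_normal_small_moments:
  "(LINT t|std_normal_distribution. t) = 0"
  "(LINT t|std_normal_distribution. t ^ 2) = 1"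
  "(LINT t|std_normal_distribution. t ^ 3) = 0"
  "(LINT t|std_normal_distribution. t ^ 4) = 3"
  using integral_std_normal_distribution_moment_odd[of 1] std_normal_distribution_even_moments(1)[of 1]
    integral_std_normal_distribution_moment_odd[of 3] std_normal_distribution_even_moments(1)[of 2]
  by (simp_all add: fact_numeral)

lemma std_normal_wick_two:
  fixes K :: "'k set"
  assumes "finite K" "a \<in> K" "b \<in> K"
  shows "has_bochner_integral (PiM K (\<lambda>_. std_normal_distribution)) (\<lambda>x. x a * x b) (of_bool (a = b))"
proof -
  have "(LINT x|PiM K (\<lambda>_. std_normal_distribution). x a * x b) = of_bool (a = b)"
    using std_normal_word_moment(2)[of K "[a, b]"] assms
    by (cases "a = b") (simp_all add: std_normal_small_moments numeral_2_eq_2[symmetric])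
  then show ?thesis
    using std_normal_word_moment(1)[of K "[a, b]"] assms by (simp add: has_bochner_integral_iff)
qed

text \<open>The Isserlis formula of order four, checked over all patterns of coinciding indices; it
  is what the variance of a quadratic form requires.\<close>

lemma std_normal_wick_four:
  fixes K :: "'k set"
  assumes "finite K" "a \<in> K" "b \<in> K" "c \<in> K" "d \<in> K"
  shows "has_bochner_integral (PiM K (\<lambda>_. std_normal_distribution)) (\<lambda>x. x a * x b * x c * x d)
    (of_bool (a = b) * of_bool (c = d) + of_bool (a = c) * of_bool (b = d) + of_bool (a = d) * of_bool (b = c))"
proof -
  note m = std_normal_small_moments
  have "(LINT x|PiM K (\<lambda>_. std_normal_distribution). x a * x b * x c * x d)
     = (\<Prod>i\<in>{a, b, c, d}. LINT t|std_normal_distribution. t ^ count_list [a, b, c, d] i)"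
    using std_normal_word_moment(2)[of K "[a, b, c, d]"] assms by (simp add: mult.assoc)
  also have "\<dots> = of_bool (a = b) * of_bool (c = d) + of_bool (a = c) * of_bool (b = d) + of_bool (a = d) * of_bool (b = c)"
    by (cases "a = b"; cases "a = c"; cases "a = d"; cases "b = c"; cases "b = d"; cases "c = d")
      (simp_all add: insert_commute m numeral_2_eq_2[symmetric] numeral_3_eq_3[symmetric]
        eval_nat_numeral(2)[symmetric])
  finally show ?thesis
    using std_normal_word_moment(1)[of K "[a, b, c, d]"] assms by (simp add: has_bochner_integral_iff mult.assoc)
qed

lemma std_normal_chaos_second_moment:
  fixes K :: "'k set"
  assumes K: "finite K"
  defines "G \<equiv> PiM K (\<lambda>_. std_normal_distribution)"
  shows "integrable G (\<lambda>x. (\<Sum>a\<in>K. \<Sum>b\<in>K. B a b * (x a * x b - of_bool (a = b)))\<^sup>2)"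
    and "(LINT x|G. (\<Sum>a\<in>K. \<Sum>b\<in>K. B a b * (x a * x b - of_bool (a = b)))\<^sup>2)
      \<le> 2 * (\<Sum>a\<in>K. \<Sum>b\<in>K. (B a b)\<^sup>2)"
proof -
  interpret prob_space G unfolding G_def by (rule prob_space_PiM_std_normal)
  let ?h = "\<lambda>x a b. x a * x b - of_bool (a = b) :: real"
  let ?V = "\<Sum>a\<in>K. \<Sum>b\<in>K. \<Sum>c\<in>K. \<Sum>d\<in>K.
      B a b * B c d * (of_bool (a = c) * of_bool (b = d) + of_bool (a = d) * of_bool (b = c))"
  \<comment> \<open>Centering both factors removes the pairing (ab)(cd), so only the two cross
    pairings remain. They give the squared entries of B and the products B_ab B_ba, the latter
    bounded by the arithmetic-geometric mean inequality.\<close>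
  have h: "has_bochner_integral G (\<lambda>x. ?h x a b * ?h x c d)
      (of_bool (a = c) * of_bool (b = d) + of_bool (a = d) * of_bool (b = c))"
    if "a \<in> K" "b \<in> K" "c \<in> K" "d \<in> K" for a b c d
  proof -
    have one: "has_bochner_integral G (\<lambda>_. of_bool (a = b) * of_bool (c = d)) (of_bool (a = b) * of_bool (c = d) :: real)"
      unfolding has_bochner_integral_iff by (simp add: prob_space)
    note w = has_bochner_integral_add[OF has_bochner_integral_diff[OF has_bochner_integral_diff[OF
          std_normal_wick_four[OF K that, folded G_def]
          has_bochner_integral_mult_left[OF std_normal_wick_two[OF K that(1,2), folded G_def], of "of_bool (c = d)"]]
          has_bochner_integral_mult_left[OF std_normal_wick_two[OF K that(3,4), folded G_def], of "of_bool (a = b)"]]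
        one]
    show ?thesis using w by (rule has_bochner_integral_cong[THEN iffD1, rotated -1]) (auto simp: algebra_simps)
  qed
  have sq: "(\<Sum>a\<in>K. \<Sum>b\<in>K. B a b * ?h x a b)\<^sup>2
      = (\<Sum>a\<in>K. \<Sum>b\<in>K. \<Sum>c\<in>K. \<Sum>d\<in>K. (B a b * B c d) * (?h x a b * ?h x c d))" for x
    unfolding power2_eq_square sum_distrib_left sum_distrib_right
    by (simp only: mult.assoc mult.commute mult.left_commute)
  have bi: "has_bochner_integral G (\<lambda>x. (\<Sum>a\<in>K. \<Sum>b\<in>K. B a b * ?h x a b)\<^sup>2) ?V"
    unfolding sq by (intro has_bochner_integral_sum has_bochner_integral_mult_right h)
  then show "integrable G (\<lambda>x. (\<Sum>a\<in>K. \<Sum>b\<in>K. B a b * ?h x a b)\<^sup>2)"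
    by (simp add: has_bochner_integral_iff)
  have "?V = (\<Sum>a\<in>K. \<Sum>b\<in>K. (B a b)\<^sup>2 + B a b * B b a)"
  proof (intro sum.cong refl)
    fix a b assume ab: "a \<in> K" "b \<in> K"
    have "B a b * B c d * (of_bool (a = c) * of_bool (b = d) + of_bool (a = d) * of_bool (b = c))
        = (if d = b then if c = a then (B a b)\<^sup>2 else 0 else 0)
        + (if d = a then if c = b then B a b * B b a else 0 else 0)" for c d
      by (simp add: power2_eq_square)
    then show "(\<Sum>c\<in>K. \<Sum>d\<in>K. B a b * B c d * (of_bool (a = c) * of_bool (b = d) + of_bool (a = d) * of_bool (b = c)))
        = (B a b)\<^sup>2 + B a b * B b a"
      using K ab by (simp add: sum.distrib)
  qed
  also have "\<dots> \<le> (\<Sum>a\<in>K. \<Sum>b\<in>K. (B a b)\<^sup>2 + ((B a b)\<^sup>2 + (B b a)\<^sup>2) / 2)"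
  proof (intro sum_mono add_left_mono)
    fix a b show "B a b * B b a \<le> ((B a b)\<^sup>2 + (B b a)\<^sup>2) / 2"
      using sum_squares_bound[of "B a b" "B b a"] by simp
  qed
  also have "\<dots> = 2 * (\<Sum>a\<in>K. \<Sum>b\<in>K. (B a b)\<^sup>2)"
    using sum.swap[of "\<lambda>a b. (B b a)\<^sup>2" K K]
    unfolding sum.distrib sum_divide_distrib[symmetric] by simp
  finally show "(LINT x|G. (\<Sum>a\<in>K. \<Sum>b\<in>K. B a b * ?h x a b)\<^sup>2) \<le> 2 * (\<Sum>a\<in>K. \<Sum>b\<in>K. (B a b)\<^sup>2)"
    using bi by (simp add: has_bochner_integral_iff)
qed

lemma std_normal_chaos_tail:
  fixes K :: "'k set"
  assumes K: "finite K" and t: "0 < t"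
  defines "G \<equiv> PiM K (\<lambda>_. std_normal_distribution)"
  shows "measure G {x \<in> space G. (\<Sum>a\<in>K. \<Sum>b\<in>K. B a b * (x a * x b - of_bool (a = b))) \<ge> t}
    \<le> 2 * (\<Sum>a\<in>K. \<Sum>b\<in>K. (B a b)\<^sup>2) / t\<^sup>2"
proof -
  interpret prob_space G unfolding G_def by (rule prob_space_PiM_std_normal)
  let ?Q = "\<lambda>x. \<Sum>a\<in>K. \<Sum>b\<in>K. B a b * (x a * x b - of_bool (a = b))"
  note int = std_normal_chaos_second_moment[OF K, of B, folded G_def]
  have "measure G {x \<in> space G. ?Q x \<ge> t} \<le> measure G {x \<in> space G. (?Q x)\<^sup>2 \<ge> t\<^sup>2}"
    using t int(1) by (intro finite_measure_mono) (auto intro: power_mono)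
  also have "\<dots> \<le> (LINT x|G. (?Q x)\<^sup>2) / t\<^sup>2"
    using t by (intro integral_Markov_inequality_measure[OF int(1) sets.empty_sets]) auto
  also have "\<dots> \<le> 2 * (\<Sum>a\<in>K. \<Sum>b\<in>K. (B a b)\<^sup>2) / t\<^sup>2"
    using int(2) by (intro divide_right_mono) auto
  finally show ?thesis .
qed

section \<open>Gaussian slices\<close>

abbreviation (input) square_index :: "nat \<Rightarrow> (nat \<times> nat) set" where
  "square_index n \<equiv> {..<n} \<times> {..<n}"

text \<open>A general set \<open>L\<close> of slice indices lets the tensor, its copy on
  \<open>{n..<2 * n}\<close> and their union be instances of one measure.\<close>

definition gauss_slices :: "nat set \<Rightarrow> nat \<Rightarrow> (nat \<times> nat \<times> nat \<Rightarrow> real) measure" where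
  "gauss_slices L n = PiM (L \<times> square_index n) (\<lambda>_. std_normal_distribution)"

lemma gauss_tensor_eq: "gauss_tensor n = gauss_slices {..<n} n"
  by (simp add: gauss_tensor_def gauss_slices_def)

lemma prob_space_gauss_slices: "prob_space (gauss_slices L n)"
  unfolding gauss_slices_def by (rule prob_space_PiM_std_normal)

lemma measurable_gauss_slices_component [measurable (raw)]:
  assumes "i \<in> L" "j < n" "k < n"
  shows "(\<lambda>A. A (i, j, k)) \<in> borel_measurable (gauss_slices L n)"
proof -
  have "(\<lambda>A. A (i, j, k)) \<in> measurable (gauss_slices L n) std_normal_distribution"
    unfolding gauss_slices_def using assms by (intro measurable_component_singleton) auto
  then show ?thesis by (simp add: measurable_def)
qed

definition slice_kron_sum :: "nat set \<Rightarrow> (nat \<times> nat \<times> nat \<Rightarrow> real) \<Rightarrow> (nat \<times> nat \<Rightarrow> nat \<times> nat \<Rightarrow> real)" where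
  "slice_kron_sum L A = (\<lambda>p q. \<Sum>i\<in>L. kron (slice A i) (slice A i) p q)"

definition slice_comb :: "nat set \<Rightarrow> (nat \<Rightarrow> real) \<Rightarrow> (nat \<times> nat \<times> nat \<Rightarrow> real) \<Rightarrow> nat \<Rightarrow> nat \<Rightarrow> real" where
  "slice_comb L u A = (\<lambda>j k. \<Sum>i\<in>L. u i * slice A i j k)"

lemma measurable_kron_slice [measurable (raw)]:
  assumes "i \<in> L" "p \<in> square_index n" "q \<in> square_index n"
  shows "(\<lambda>A. kron (slice A i) (slice A i) p q) \<in> borel_measurable (gauss_slices L n)"
  using assms unfolding kron_def slice_def
  by (cases p; cases q) (auto intro!: borel_measurable_times measurable_gauss_slices_component)

lemma measurable_bil:
  assumes "\<And>i j. i \<in> I \<Longrightarrow> j \<in> J \<Longrightarrow> (\<lambda>\<omega>. A \<omega> i j) \<in> borel_measurable M"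
  shows "(\<lambda>\<omega>. bil I J (A \<omega>) y x) \<in> borel_measurable M"
  unfolding bil_def
  by (intro borel_measurable_sum borel_measurable_times borel_measurable_const assms)

lemma measurable_mat_vec:
  assumes "\<And>j. j \<in> J \<Longrightarrow> (\<lambda>\<omega>. A \<omega> i j) \<in> borel_measurable M"
    and "\<And>j. j \<in> J \<Longrightarrow> (\<lambda>\<omega>. x \<omega> j) \<in> borel_measurable M"
  shows "(\<lambda>\<omega>. mat_vec I J (A \<omega>) (x \<omega>) i) \<in> borel_measurable M"
  unfolding mat_vec_def
  by (intro borel_measurable_sum borel_measurable_times assms)

lemma measurable_gram_trace:
  assumes A: "\<And>i j. i \<in> K \<Longrightarrow> j \<in> J \<Longrightarrow> (\<lambda>\<omega>. A \<omega> i j) \<in> borel_measurable M"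
  shows "(\<lambda>\<omega>. gram_trace K J (A \<omega>) p) \<in> borel_measurable M"
proof -
  have "(\<lambda>\<omega>. (gram K J (A \<omega>) ^^ p) e k) \<in> borel_measurable M" if "k \<in> K" for e k
    using that
  proof (induction p arbitrary: k)
    case (Suc p)
    have "(\<lambda>\<omega>. gram K J (A \<omega>) (z \<omega>) k) \<in> borel_measurable M"
      if "\<And>i. i \<in> K \<Longrightarrow> (\<lambda>\<omega>. z \<omega> i) \<in> borel_measurable M" for z
      unfolding gram_def transp_mat_def using A Suc.prems that by (intro measurable_mat_vec) auto
    from this[OF Suc.IH] show ?case by simp
  qed simp
  then show ?thesis
    unfolding gram_trace_def by (intro borel_measurable_sum) auto
qed

lemma std_normal_linear_union_tail:
  fixes c :: "'s \<Rightarrow> 'k \<Rightarrow> real"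
  assumes K: "finite K" and S: "finite S" and c: "\<And>s. s \<in> S \<Longrightarrow> (\<Sum>a\<in>K. (c s a)\<^sup>2) \<le> 1" and t: "0 \<le> t"
  defines "G \<equiv> PiM K (\<lambda>_. std_normal_distribution)"
  shows "measure G {x \<in> space G. \<exists>s\<in>S. (\<Sum>a\<in>K. c s a * x a) \<ge> t} \<le> card S * exp (- t\<^sup>2 / 2)"
proof -
  interpret prob_space G unfolding G_def by (rule prob_space_PiM_std_normal)
  have m: "(\<lambda>x. \<Sum>a\<in>K. c s a * x a) \<in> borel_measurable G" for s
  proof (intro borel_measurable_sum borel_measurable_times borel_measurable_const)
    fix a assume "a \<in> K"
    then have "(\<lambda>x. x a) \<in> measurable G std_normal_distribution"
      unfolding G_def by (rule measurable_component_singleton)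
    then show "(\<lambda>x. x a) \<in> borel_measurable G" by (simp add: measurable_def)
  qed
  have ev: "{x \<in> space G. (\<Sum>a\<in>K. c s a * x a) \<ge> t} \<in> events" for s
    using m by measurable
  have "{x \<in> space G. \<exists>s\<in>S. (\<Sum>a\<in>K. c s a * x a) \<ge> t} = (\<Union>s\<in>S. {x \<in> space G. (\<Sum>a\<in>K. c s a * x a) \<ge> t})"
    by auto
  also have "measure G \<dots> \<le> (\<Sum>s\<in>S. measure G {x \<in> space G. (\<Sum>a\<in>K. c s a * x a) \<ge> t})"
    using ev by (intro finite_measure_subadditive_finite S) auto
  also have "\<dots> \<le> (\<Sum>s\<in>S. exp (- t\<^sup>2 / 2))"
    unfolding G_def by (intro sum_mono std_normal_linear_tail K c t)
  finally show ?thesis by simp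
qed

text \<open>Each net pair gives a linear form in the entries with coefficients u_i y_j x_k of norm
  at most 1. Level 8 sqrt n yields exp(-32 n), against 2^(36 n) \<le> exp(25 n) pairs. A general u
  covers both G = sum_i v0_i A_i and, through an indicator, a single slice.\<close>

lemma slice_comb_tail:
  fixes n :: nat
  assumes L: "finite L" and u: "(\<Sum>i\<in>L. (u i)\<^sup>2) \<le> 1"
  defines "G \<equiv> gauss_slices L n"
  shows "measure G {A \<in> space G. \<exists>y\<in>lattice_net {..<n}. \<exists>x\<in>lattice_net {..<n}.
      bil {..<n} {..<n} (slice_comb L u A) y x \<ge> 8 * sqrt n} \<le> exp (- 7 * real n)"
proof -
  define S where "S = lattice_net {..<n} \<times> lattice_net {..<n}"
  define c :: "(nat \<Rightarrow> real) \<times> (nat \<Rightarrow> real) \<Rightarrow> nat \<times> nat \<times> nat \<Rightarrow> real"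
    where "c = (\<lambda>(y, x) (i, j, k). u i * y j * x k)"
  have eq: "bil {..<n} {..<n} (slice_comb L u A) y x = (\<Sum>a\<in>L \<times> square_index n. c (y, x) a * A a)" for A y x
  proof -
    have "bil {..<n} {..<n} (slice_comb L u A) y x
        = (\<Sum>j<n. \<Sum>k<n. \<Sum>i\<in>L. c (y, x) (i, j, k) * A (i, j, k))"
      by (simp add: bil_def slice_comb_def slice_def c_def sum_distrib_left sum_distrib_right mult.assoc mult.left_commute mult.commute)
    also have "\<dots> = (\<Sum>j<n. \<Sum>i\<in>L. \<Sum>k<n. c (y, x) (i, j, k) * A (i, j, k))"
      by (rule sum.cong[OF refl]) (rule sum.swap)
    also have "\<dots> = (\<Sum>i\<in>L. \<Sum>j<n. \<Sum>k<n. c (y, x) (i, j, k) * A (i, j, k))"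
      by (rule sum.swap)
    finally show ?thesis by (simp add: sum.cartesian_product')
  qed
  have c: "(\<Sum>a\<in>L \<times> square_index n. (c s a)\<^sup>2) \<le> 1" if s': "s \<in> S" for s
  proof -
    obtain y x where s: "s = (y, x)" "y \<in> lattice_net {..<n}" "x \<in> lattice_net {..<n}"
      using s' by (auto simp: S_def)
    have "(\<Sum>a\<in>L \<times> square_index n. (c s a)\<^sup>2) = (\<Sum>i\<in>L. (u i)\<^sup>2) * ((vnorm {..<n} y)\<^sup>2 * (vnorm {..<n} x)\<^sup>2)"
      unfolding vnorm_power2 s(1)
      by (simp add: c_def sum.cartesian_product' power_mult_distrib mult.assoc flip: sum_distrib_left sum_distrib_right)
    also have "\<dots> \<le> 1 * (1 * 1)"
      using u vnorm_lattice_net_le[OF s(2)] vnorm_lattice_net_le[OF s(3)]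
      by (intro mult_mono) (auto simp: power_le_one sum_nonneg)
    finally show ?thesis by simp
  qed
  have finS: "finite S" by (simp add: S_def finite_lattice_net)
  have "{A \<in> space G. \<exists>y\<in>lattice_net {..<n}. \<exists>x\<in>lattice_net {..<n}.
      bil {..<n} {..<n} (slice_comb L u A) y x \<ge> 8 * sqrt n}
    = {A \<in> space G. \<exists>s\<in>S. (\<Sum>a\<in>L \<times> square_index n. c s a * A a) \<ge> 8 * sqrt n}"
    unfolding eq S_def by auto
  also have "measure G \<dots> \<le> card S * exp (- (8 * sqrt n)\<^sup>2 / 2)"
    unfolding G_def gauss_slices_def
    by (intro std_normal_linear_union_tail finS c) (use L in auto)
  also have "\<dots> = card S * exp (- 32 * real n)" by (simp add: power_mult_distrib)
  also have "\<dots> \<le> exp (25 * real n) * exp (- 32 * real n)"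
  proof (intro mult_right_mono)
    have "real (card S) = real (card (lattice_net {..<n})) * real (card (lattice_net {..<n}))"
      by (simp add: S_def card_cartesian_product)
    also have "\<dots> \<le> 2 ^ (18 * n) * 2 ^ (18 * n)"
      using card_lattice_net[of "{..<n}"] by (intro mult_mono) auto
    also have "\<dots> = (2::real) ^ (36 * n)" by (simp flip: power_add)
    also have "\<dots> = exp (36 * real n * ln 2)" by (simp add: powr_def flip: powr_realpow)
    also have "\<dots> \<le> exp (25 * real n)"
      using mult_left_mono[OF ln2_le_25_over_36, of "36 * real n"] by simp
    finally show "real (card S) \<le> exp (25 * real n)" .
  qed simp
  also have "\<dots> = exp (- 7 * real n)" by (simp flip: exp_add)
  finally show ?thesis .
qed

text \<open>Phrased on the finite net instead of through norms, so that the event is measurable and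
  its complement is covered by the union bound.\<close>

definition good_slices :: "nat \<Rightarrow> (nat \<times> nat \<times> nat \<Rightarrow> real) \<Rightarrow> bool" where
  "good_slices n A \<longleftrightarrow> (\<forall>i<2 * n. \<forall>y\<in>lattice_net {..<n}. \<forall>x\<in>lattice_net {..<n}.
     bil {..<n} {..<n} (slice A i) y x < 8 * sqrt n)"

lemma measurable_bil_slice:
  "i \<in> L \<Longrightarrow> (\<lambda>A. bil {..<n} {..<n} (slice A i) y x) \<in> borel_measurable (gauss_slices L n)"
  unfolding slice_def by (intro measurable_bil measurable_gauss_slices_component) auto

lemma sets_good_slices:
  "{A \<in> space (gauss_slices {..<2 * n} n). good_slices n A} \<in> sets (gauss_slices {..<2 * n} n)"
proof -
  have "{A \<in> space (gauss_slices {..<2 * n} n). bil {..<n} {..<n} (slice A i) y x < 8 * sqrt n}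
      \<in> sets (gauss_slices {..<2 * n} n)" if "i < 2 * n" for i y x
  proof -
    have [measurable]: "(\<lambda>A. bil {..<n} {..<n} (slice A i) y x) \<in> borel_measurable (gauss_slices {..<2 * n} n)"
      using that by (intro measurable_bil_slice) auto
    show ?thesis by measurable
  qed
  then show ?thesis
    unfolding good_slices_def lessThan_iff[symmetric] Ball_def[symmetric]
    by (intro sets.sets_Collect_finite_All finite_lattice_net) auto
qed

lemma good_slices_op_bound:
  assumes "good_slices n A" "i < 2 * n"
  shows "op_bound {..<n} {..<n} (slice A i) (16 * sqrt n)"
  using op_bound_lattice_net[of "{..<n}" "{..<n}" "8 * sqrt n" "slice A i"] assms
  by (fastforce simp: good_slices_def)

lemma good_slices_prob:
  fixes n :: nat
  defines "G \<equiv> gauss_slices {..<2 * n} n"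
  shows "measure G {A \<in> space G. \<not> good_slices n A} \<le> 2 * real n * exp (- 7 * real n)"
proof -
  interpret prob_space G unfolding G_def by (rule prob_space_gauss_slices)
  let ?B = "\<lambda>i. {A \<in> space G. \<exists>y\<in>lattice_net {..<n}. \<exists>x\<in>lattice_net {..<n}.
      bil {..<n} {..<n} (slice_comb {..<2 * n} (indicator {i}) A) y x \<ge> 8 * sqrt n}"
  have comb: "slice_comb {..<2 * n} (indicator {i}) A = slice A i" if "i < 2 * n" for i A
  proof -
    have "(\<Sum>i'<2 * n. indicator {i} i' * slice A i' j k) = (\<Sum>i'<2 * n. if i' = i then slice A i' j k else 0)" for j k
      by (intro sum.cong) auto
    then show ?thesis using that by (simp add: slice_comb_def)
  qed
  have ev: "?B i \<in> events" if "i < 2 * n" for i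
  proof -
    have "{A \<in> space G. bil {..<n} {..<n} (slice A i) y x \<ge> 8 * sqrt n} \<in> events" for y x
    proof -
      have [measurable]: "(\<lambda>A. bil {..<n} {..<n} (slice A i) y x) \<in> borel_measurable G"
        unfolding G_def using that by (intro measurable_bil_slice) auto
      show ?thesis by measurable
    qed
    then show ?thesis unfolding comb[OF that]
      by (intro sets.sets_Collect_finite_Ex finite_lattice_net) auto
  qed
  have "{A \<in> space G. \<not> good_slices n A} \<subseteq> (\<Union>i<2 * n. ?B i)"
    by (auto simp: good_slices_def comb not_less)
  then have "measure G {A \<in> space G. \<not> good_slices n A} \<le> measure G (\<Union>i<2 * n. ?B i)"
    using ev by (intro finite_measure_mono) auto
  also have "\<dots> \<le> (\<Sum>i<2 * n. measure G (?B i))"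
    using ev by (intro finite_measure_subadditive_finite) auto
  also have "\<dots> \<le> (\<Sum>i<2 * n. exp (- 7 * real n))"
  proof (intro sum_mono)
    fix i assume "i \<in> {..<2 * n}"
    then have "(\<Sum>i'<2 * n. (indicator {i} i' :: real)\<^sup>2) \<le> 1"
      by (simp add: indicator_def of_bool_def if_distrib[of "\<lambda>t. t\<^sup>2"] cong: if_cong)
    then show "measure G (?B i) \<le> exp (- 7 * real n)"
      unfolding G_def by (intro slice_comb_tail) auto
  qed
  finally show ?thesis by simp
qed

section \<open>Exchanging slices\<close>

text \<open>Exchanged tensors are restricted to their index set, so sign identities hold only for
  entries inside it; this transfers them to traces.\<close>

lemma gram_funpow_cong:
  assumes eq: "\<And>k j. k \<in> K \<Longrightarrow> j \<in> J \<Longrightarrow> A k j = B k j" and "k \<in> K"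
  shows "(gram K J A ^^ p) e k = (gram K J B ^^ p) e k"
  using assms(2)
proof (induction p arbitrary: k)
  case (Suc p)
  have "gram K J A z k = gram K J B w k" if "\<And>k. k \<in> K \<Longrightarrow> z k = w k" for z w
    using that eq Suc.prems by (simp add: gram_def mat_vec_def transp_mat_def)
  from this[OF Suc.IH] show ?case by simp
qed simp

lemma gram_trace_cong:
  assumes "\<And>k j. k \<in> K \<Longrightarrow> j \<in> J \<Longrightarrow> A k j = B k j"
  shows "gram_trace K J A p = gram_trace K J B p"
  unfolding gram_trace_def by (rule sum.cong[OF refl]) (rule gram_funpow_cong[OF assms])

lemma gram_trace_even_nonneg: "finite K \<Longrightarrow> 0 \<le> gram_trace K J A (2 * q)"
  by (simp add: gram_trace_double sum_nonneg)

text \<open>The independent copy occupies the slices \<open>n, \<dots>, 2n - 1\<close> of a single tensor with \<open>2n\<close> slices.\<close>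
definition slice_pair_diff :: "nat \<Rightarrow> (nat \<times> nat \<times> nat \<Rightarrow> real) \<Rightarrow> nat \<Rightarrow> (nat \<times> nat \<Rightarrow> nat \<times> nat \<Rightarrow> real)" where
  "slice_pair_diff n A i = (\<lambda>p q. kron (slice A i) (slice A i) p q - kron (slice A (n + i)) (slice A (n + i)) p q)"

text \<open>For i < 2n, \<open>i mod n\<close> names the pair {i, i + n} to which a slice belongs. A
  sign other than 1 exchanges the two members.\<close>

definition swap_index :: "nat \<Rightarrow> (nat \<Rightarrow> real) \<Rightarrow> nat \<times> nat \<times> nat \<Rightarrow> nat \<times> nat \<times> nat" where
  "swap_index n s = (\<lambda>(i, j, k). (if s (i mod n) = 1 then i else if i < n then i + n else i - n, j, k))"

definition swap_slices :: "nat \<Rightarrow> (nat \<Rightarrow> real) \<Rightarrow> (nat \<times> nat \<times> nat \<Rightarrow> real) \<Rightarrow> (nat \<times> nat \<times> nat \<Rightarrow> real)" where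
  "swap_slices n s A = (\<lambda>a\<in>{..<2 * n} \<times> square_index n. A (swap_index n s a))"

lemma swap_index_mem: "swap_index n s \<in> {..<2 * n} \<times> square_index n \<rightarrow> {..<2 * n} \<times> square_index n"
  by (auto simp: swap_index_def)

lemma swap_index_involutive:
  assumes "a \<in> {..<2 * n} \<times> square_index n"
  shows "swap_index n s (swap_index n s a) = a"
proof -
  have "i mod n = (if i < n then i else i - n)" if "i < 2 * n" for i
    using that by (auto simp: mod_if)
  then show ?thesis using assms by (auto simp: swap_index_def)
qed

lemma measurable_swap_slices:
  "swap_slices n s \<in> measurable (gauss_slices {..<2 * n} n) (gauss_slices {..<2 * n} n)"
  unfolding swap_slices_def gauss_slices_def
  using swap_index_mem[of n s] by (intro measurable_restrict measurable_component_singleton) auto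

lemma distr_swap_slices:
  "distr (gauss_slices {..<2 * n} n) (gauss_slices {..<2 * n} n) (swap_slices n s) = gauss_slices {..<2 * n} n"
proof -
  have "inj_on (swap_index n s) ({..<2 * n} \<times> square_index n)"
    by (rule inj_on_inverseI) (rule swap_index_involutive)
  then show ?thesis
    unfolding gauss_slices_def swap_slices_def
    by (intro distr_PiM_reindex prob_space_normal_density swap_index_mem) simp
qed

lemma slice_swap_slices:
  assumes "i < n" "j < n" "k < n"
  shows "slice (swap_slices n s A) i j k = slice A (if s i = 1 then i else n + i) j k"
    and "slice (swap_slices n s A) (n + i) j k = slice A (if s i = 1 then n + i else i) j k"
  using assms by (simp_all add: slice_def swap_slices_def swap_index_def add.commute)

text \<open>Exchanging a pair negates its difference. Since the exchange preserves the measure, the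
  signs are realised on the tensor itself, without a second probability space.\<close>

lemma slice_pair_diff_swap:
  assumes "s \<in> sign_vectors {..<n}" "i < n" "p \<in> square_index n" "q \<in> square_index n"
  shows "slice_pair_diff n (swap_slices n s A) i p q = s i * slice_pair_diff n A i p q"
proof -
  have "s i = 1 \<or> s i = - 1" using assms(1,2) by (auto simp: sign_vectors_def PiE_def Pi_def)
  then show ?thesis
    using assms by (cases p; cases q) (auto simp: slice_pair_diff_def kron_def slice_swap_slices)
qed

text \<open>The condition concerns all 2n slices at once and the exchange permutes them. This
  direction lets a good exchanged tensor be conditioned on through the original one.\<close>

lemma good_slices_swap:
  assumes "good_slices n (swap_slices n s A)"
  shows "good_slices n A"
  unfolding good_slices_def
proof (intro allI impI ballI)
  fix i y x assume i: "i < 2 * n" and yx: "y \<in> lattice_net {..<n}" "x \<in> lattice_net {..<n}"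
  define i' where "i' = (if s (i mod n) = 1 then i else if i < n then i + n else i - n)"
  have i': "i' < 2 * n" using i by (auto simp: i'_def)
  have "slice (swap_slices n s A) i' j k = slice A i j k" if "j < n" "k < n" for j k
  proof -
    have "swap_index n s (i', j, k) = (i, j, k)"
      using swap_index_involutive[of "(i, j, k)" n s] i that by (simp add: swap_index_def i'_def)
    then show ?thesis using i' that by (simp add: slice_def swap_slices_def)
  qed
  then have "bil {..<n} {..<n} (slice A i) y x = bil {..<n} {..<n} (slice (swap_slices n s A) i') y x"
    by (intro bil_cong) auto
  then show "bil {..<n} {..<n} (slice A i) y x < 8 * sqrt n"
    using assms i' yx by (simp add: good_slices_def)
qed

text \<open>Each C_i is a difference of two Kronecker squares, so its norm is at most 2 (16 sqrt
  n)^2 = 512 n, and n (512 n)^2 = 2^18 n^3. The factor n^2 is the dimension.\<close>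

lemma good_slices_signed_trace:
  assumes good: "good_slices n A" and n: "n > 0" and p: "p > 0"
  shows "(\<Sum>s\<in>sign_vectors {..<n}. gram_trace (square_index n) (square_index n)
      (\<lambda>a b. \<Sum>i<n. s i * slice_pair_diff n A i a b) p)
    \<le> 2 ^ n * (2 * (real n)\<^sup>2 * (2 * exp 1 * real p * (2 ^ 18 * real n ^ 3)) ^ p)"
proof -
  have C: "op_bound (square_index n) (square_index n) (slice_pair_diff n A i) (512 * real n)" if "i \<in> {..<n}" for i
  proof -
    have "op_bound (square_index n) (square_index n) (slice_pair_diff n A i)
        (16 * sqrt n * (16 * sqrt n) + 16 * sqrt n * (16 * sqrt n))"
      unfolding slice_pair_diff_def
      using that by (intro op_bound_diff op_bound_kron good_slices_op_bound[OF good]) auto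
    then show ?thesis by simp
  qed
  have "(\<Sum>i<n. (512 * real n)\<^sup>2) \<le> 2 ^ 18 * real n ^ 3"
    by (simp add: power2_eq_square power3_eq_cube)
  then have "(\<Sum>s\<in>sign_vectors {..<n}. (\<Sum>i<n. s i * (512 * real n)) ^ (2 * p))
      \<le> 2 ^ Suc n * (2 * exp 1 * real p * (2 ^ 18 * real n ^ 3)) ^ p"
    using sum_signs_power_le[of "{..<n}" "\<lambda>_. 512 * real n" "2 ^ 18 * real n ^ 3" p] n p by simp
  then have "real (card (square_index n)) * (\<Sum>s\<in>sign_vectors {..<n}. (\<Sum>i<n. s i * (512 * real n)) ^ (2 * p))
      \<le> real (card (square_index n)) * (2 ^ Suc n * (2 * exp 1 * real p * (2 ^ 18 * real n ^ 3)) ^ p)"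
    by (intro mult_left_mono) auto
  moreover have "(\<Sum>s\<in>sign_vectors {..<n}. gram_trace (square_index n) (square_index n)
      (\<lambda>a b. \<Sum>i<n. s i * slice_pair_diff n A i a b) p)
    \<le> real (card (square_index n)) * (\<Sum>s\<in>sign_vectors {..<n}. (\<Sum>i<n. s i * (512 * real n)) ^ (2 * p))"
    by (intro sum_signs_gram_trace_le C) auto
  ultimately show ?thesis by (simp add: power2_eq_square mult.assoc mult.left_commute)
qed

definition pair_diff_trace :: "nat \<Rightarrow> nat \<Rightarrow> (nat \<times> nat \<times> nat \<Rightarrow> real) \<Rightarrow> real" where
  "pair_diff_trace n p A = gram_trace (square_index n) (square_index n) (\<lambda>a b. \<Sum>i<n. slice_pair_diff n A i a b) p"

lemma measurable_pair_diff_trace: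
  "pair_diff_trace n p \<in> borel_measurable (gauss_slices {..<2 * n} n)"
proof -
  have "(\<lambda>A. slice_pair_diff n A i a b) \<in> borel_measurable (gauss_slices {..<2 * n} n)"
    if "i < n" "a \<in> square_index n" "b \<in> square_index n" for i a b
    unfolding slice_pair_diff_def using that by (intro borel_measurable_diff measurable_kron_slice) auto
  then have "(\<lambda>A. pair_diff_trace n p A) \<in> borel_measurable (gauss_slices {..<2 * n} n)"
    unfolding pair_diff_trace_def by (intro measurable_gram_trace borel_measurable_sum) auto
  then show ?thesis by simp
qed

lemma pair_diff_trace_tail:
  fixes n m :: nat
  assumes n: "n > 0" and T: "T > 0"
  defines "Q \<equiv> gauss_slices {..<2 * n} n" and "p \<equiv> 2 ^ Suc m"
  shows "measure Q {A \<in> space Q. pair_diff_trace n p A \<ge> T}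
    \<le> 2 * real n * exp (- 7 * real n) + 2 * (real n)\<^sup>2 * (2 * exp 1 * real p * (2 ^ 18 * real n ^ 3)) ^ p / T"
proof -
  interpret prob_space Q unfolding Q_def by (rule prob_space_gauss_slices)
  define \<delta> where "\<delta> = 2 * (real n)\<^sup>2 * (2 * exp 1 * real p * (2 ^ 18 * real n ^ 3)) ^ p"
  define H where "H = {A \<in> space Q. good_slices n A}"
  define Ev where "Ev = {A \<in> space Q. pair_diff_trace n p A \<ge> T}"
  define F where "F = (\<lambda>s. {A \<in> space Q. good_slices n A \<and> pair_diff_trace n p (swap_slices n s A) \<ge> T})"
  note [measurable] = measurable_pair_diff_trace[of n p, folded Q_def] measurable_swap_slices[of n, folded Q_def]
    sets_good_slices[of n, folded Q_def]
  have H_ev: "H \<in> events" unfolding H_def by measurable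
  have Ev_ev: "Ev \<in> events" unfolding Ev_def by measurable
  have F_ev: "F s \<in> events" for s unfolding F_def by measurable
  \<comment> \<open>Every sign vector yields the same upper bound by invariance, so these bounds may
    later be averaged over all s.\<close>
  have le: "measure Q (Ev \<inter> H) \<le> measure Q (F s)" for s
  proof -
    have "measure Q (Ev \<inter> H) = measure (distr Q Q (swap_slices n s)) (Ev \<inter> H)"
      by (simp add: Q_def distr_swap_slices)
    also have "\<dots> = measure Q (swap_slices n s -` (Ev \<inter> H) \<inter> space Q)"
      using Ev_ev H_ev by (intro measure_distr) auto
    also have "\<dots> \<le> measure Q (F s)"
      using F_ev by (intro finite_measure_mono) (auto simp: F_def Ev_def H_def dest: good_slices_swap)
    finally show ?thesis .
  qed
  have p_even: "p = 2 * 2 ^ m" by (simp add: p_def)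
  \<comment> \<open>Markov's inequality over the uniform signs with A held fixed: the trace is
    nonnegative because p is even, so its average controls how many s exceed T.\<close>
  have ptw: "(\<Sum>s\<in>sign_vectors {..<n}. indicator (F s) A) \<le> 2 ^ n * \<delta> / T" for A
  proof (cases "good_slices n A")
    case True
    let ?R = "\<lambda>s. gram_trace (square_index n) (square_index n) (\<lambda>a b. \<Sum>i<n. s i * slice_pair_diff n A i a b) p"
    have R: "pair_diff_trace n p (swap_slices n s A) = ?R s" if "s \<in> sign_vectors {..<n}" for s
      unfolding pair_diff_trace_def
      using that by (intro gram_trace_cong sum.cong refl slice_pair_diff_swap) auto
    have "indicator (F s) A \<le> ?R s / T" if "s \<in> sign_vectors {..<n}" for s
      using gram_trace_even_nonneg[of "square_index n" "square_index n" "\<lambda>a b. \<Sum>i<n. s i * slice_pair_diff n A i a b" "2 ^ m"]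
        T R[OF that] by (auto simp: F_def indicator_def p_even)
    then have "(\<Sum>s\<in>sign_vectors {..<n}. indicator (F s) A) \<le> (\<Sum>s\<in>sign_vectors {..<n}. ?R s / T)"
      by (rule sum_mono)
    also have "\<dots> = (\<Sum>s\<in>sign_vectors {..<n}. ?R s) / T" by (rule sum_divide_distrib[symmetric])
    also have "\<dots> \<le> 2 ^ n * \<delta> / T"
      using good_slices_signed_trace[OF True n, of p] T
      by (intro divide_right_mono) (auto simp: \<delta>_def p_def)
    finally show ?thesis .
  next
    case False
    then have "(\<Sum>s\<in>sign_vectors {..<n}. indicator (F s) A) = (0::real)" by (simp add: F_def)
    moreover have "0 \<le> 2 ^ n * \<delta> / T" using T by (simp add: \<delta>_def)
    ultimately show ?thesis by linarith
  qed
  have "2 ^ n * measure Q (Ev \<inter> H) = (\<Sum>s\<in>sign_vectors {..<n}. measure Q (Ev \<inter> H))"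
    by (simp add: card_sign_vectors)
  also have "\<dots> \<le> (\<Sum>s\<in>sign_vectors {..<n}. measure Q (F s))" by (intro sum_mono le)
  also have "\<dots> = (\<Sum>s\<in>sign_vectors {..<n}. LINT A|Q. indicator (F s) A)"
    using F_ev sets.sets_into_space by (intro sum.cong refl) (simp add: Int_absorb2)
  also have "\<dots> = (LINT A|Q. (\<Sum>s\<in>sign_vectors {..<n}. indicator (F s) A))"
    using F_ev by (intro Bochner_Integration.integral_sum[symmetric] integrable_real_indicator) (auto simp: emeasure_eq_measure)
  also have "\<dots> \<le> (LINT A|Q. 2 ^ n * \<delta> / T)"
    using F_ev by (intro integral_mono ptw integrable_sum integrable_real_indicator) (auto simp: emeasure_eq_measure)
  also have "\<dots> = 2 ^ n * (\<delta> / T)" by (simp add: prob_space)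
  finally have 1: "measure Q (Ev \<inter> H) \<le> \<delta> / T" by (rule mult_left_le_imp_le) simp
  have "measure Q Ev \<le> measure Q ((Ev \<inter> H) \<union> (space Q - H))"
    using Ev_ev H_ev by (intro finite_measure_mono) (auto simp: Ev_def)
  also have "\<dots> \<le> measure Q (Ev \<inter> H) + measure Q (space Q - H)"
    using Ev_ev H_ev by (intro measure_Un_le) auto
  also have "space Q - H = {A \<in> space Q. \<not> good_slices n A}" by (auto simp: H_def)
  also have "measure Q \<dots> \<le> 2 * real n * exp (- 7 * real n)"
    unfolding Q_def by (rule good_slices_prob)
  finally show ?thesis using 1 by (simp add: Ev_def \<delta>_def)
qed

section \<open>Symmetrization\<close>

text \<open>Fubini form of symmetrization: an event whose sections over B have probability at least
  1/2 has at least half the measure of B.\<close>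

lemma measure_pair_ge_half:
  assumes N: "prob_space N" and N': "prob_space N'"
    and E: "E \<in> sets (N \<Otimes>\<^sub>M N')" and B: "B \<in> sets N"
    and half: "\<And>a. a \<in> B \<Longrightarrow> measure N' (Pair a -` E) \<ge> 1/2"
  shows "measure N B \<le> 2 * measure (N \<Otimes>\<^sub>M N') E"
proof -
  interpret N: prob_space N by (rule N)
  interpret N': prob_space N' by (rule N')
  interpret P: pair_prob_space N N' ..
  have "ennreal (1/2 * measure N B) = ennreal (1/2) * emeasure N B"
    unfolding N.emeasure_eq_measure by (rule ennreal_mult) auto
  also have "\<dots> = (\<integral>\<^sup>+ a. ennreal (1/2) * indicator B a \<partial>N)"
    using B by (simp add: nn_integral_cmult_indicator)
  also have "\<dots> \<le> (\<integral>\<^sup>+ a. emeasure N' (Pair a -` E) \<partial>N)"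
  proof (rule nn_integral_mono)
    fix a
    show "ennreal (1/2) * indicator B a \<le> emeasure N' (Pair a -` E)"
    proof (cases "a \<in> B")
      case True
      have "ennreal (1/2) \<le> emeasure N' (Pair a -` E)"
        unfolding N'.emeasure_eq_measure by (rule ennreal_leI[OF half[OF True]])
      then show ?thesis using True by simp
    qed simp
  qed
  also have "\<dots> = emeasure (N \<Otimes>\<^sub>M N') E" by (rule N'.emeasure_pair_measure_alt[OF E, symmetric])
  finally have "ennreal (1/2 * measure N B) \<le> ennreal (measure (N \<Otimes>\<^sub>M N') E)"
    unfolding P.emeasure_eq_measure .
  then have "1/2 * measure N B \<le> measure (N \<Otimes>\<^sub>M N') E"
    by (subst (asm) ennreal_le_iff) auto
  then show ?thesis by simp
qed

definition centered_kron_sum :: "nat set \<Rightarrow> nat \<Rightarrow> (nat \<times> nat \<times> nat \<Rightarrow> real) \<Rightarrow> (nat \<times> nat \<Rightarrow> nat \<times> nat \<Rightarrow> real)" where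
  "centered_kron_sum L n A = (\<lambda>p q. slice_kron_sum L A p q - real n * flat_id p * flat_id q)"

text \<open>The row index (j, k) and column index (j', k') of a Kronecker square regroup into the
  Gaussian indices (i, j, j') and (i, k, k'). Since \<open>card L = n\<close>, subtracting n w w^T
  is exactly the centering of the diagonal products.\<close>

lemma bil_centered_kron_sum_eq_chaos:
  fixes n :: nat and x y :: "nat \<times> nat \<Rightarrow> real"
  assumes L: "finite L" "card L = n"
  defines "B \<equiv> \<lambda>(i, j, j') (i', k, k'). of_bool (i = i') * (y (j, k) * x (j', k')) :: real"
  shows "bil (square_index n) (square_index n) (centered_kron_sum L n A) y x
    = (\<Sum>a\<in>L \<times> square_index n. \<Sum>b\<in>L \<times> square_index n. B a b * (A a * A b - of_bool (a = b)))"
proof -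
  let ?f = "\<lambda>i j k j' k'. y (j, k) * x (j', k') * (A (i, j, j') * A (i, k, k') - of_bool (j = k) * of_bool (j' = k'))"
  have "y (j, k) * centered_kron_sum L n A (j, k) (j', k') * x (j', k') = (\<Sum>i\<in>L. ?f i j k j' k')" for j k j' k'
    using L by (simp add: centered_kron_sum_def slice_kron_sum_def kron_def slice_def flat_id_def
        sum_subtractf sum_distrib_left sum_distrib_right algebra_simps)
  then have "bil (square_index n) (square_index n) (centered_kron_sum L n A) y x
      = (\<Sum>j<n. \<Sum>k<n. \<Sum>j'<n. \<Sum>k'<n. \<Sum>i\<in>L. ?f i j k j' k')"
    by (simp add: bil_def sum.cartesian_product')
  also have "\<dots> = (\<Sum>i\<in>L. \<Sum>j<n. \<Sum>k<n. \<Sum>j'<n. \<Sum>k'<n. ?f i j k j' k')"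
    by (simp only: sum.swap[of _ L])
  \<comment> \<open>Exchanging k with j' collects the indices of each Gaussian factor; a second
    slice index i' is then introduced by a diagonal sum.\<close>
  also have "\<dots> = (\<Sum>i\<in>L. \<Sum>j<n. \<Sum>j'<n. \<Sum>k<n. \<Sum>k'<n. ?f i j k j' k')"
    by (rule sum.cong[OF refl], rule sum.cong[OF refl], rule sum.swap)
  also have "\<dots> = (\<Sum>i\<in>L. \<Sum>j<n. \<Sum>j'<n. \<Sum>i'\<in>L. if i' = i then \<Sum>k<n. \<Sum>k'<n. ?f i j k j' k' else 0)"
    using L by simp
  also have "\<dots> = (\<Sum>i\<in>L. \<Sum>j<n. \<Sum>j'<n. \<Sum>i'\<in>L. \<Sum>k<n. \<Sum>k'<n.
      B (i, j, j') (i', k, k') * (A (i, j, j') * A (i', k, k') - of_bool ((i, j, j') = (i', k, k'))))"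
    by (intro sum.cong refl) (auto simp: B_def intro!: sum.cong)
  finally show ?thesis by (simp add: sum.cartesian_product')
qed

text \<open>Regrouping indices preserves the Frobenius norm, so each of the n slices contributes
  ||y||^2 ||x||^2 \<le> 1. The second moment is at most 2n, and level 2 sqrt n gives 2n / (4n) =
  1/2.\<close>

lemma bil_centered_kron_sum_tail:
  fixes n :: nat
  assumes L: "finite L" "card L = n" and n: "n > 0"
    and y: "vnorm (square_index n) y \<le> 1" and x: "vnorm (square_index n) x \<le> 1"
  defines "G \<equiv> gauss_slices L n"
  shows "measure G {A \<in> space G. bil (square_index n) (square_index n) (centered_kron_sum L n A) y x \<ge> 2 * sqrt n} \<le> 1/2"
proof -
  define B :: "nat \<times> nat \<times> nat \<Rightarrow> nat \<times> nat \<times> nat \<Rightarrow> real"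
    where "B = (\<lambda>(i, j, j') (i', k, k'). of_bool (i = i') * (y (j, k) * x (j', k')))"
  have "(\<Sum>a\<in>L \<times> square_index n. \<Sum>b\<in>L \<times> square_index n. (B a b)\<^sup>2)
      = (\<Sum>i\<in>L. \<Sum>j<n. \<Sum>j'<n. \<Sum>i'\<in>L. if i' = i then \<Sum>k<n. \<Sum>k'<n. (y (j, k))\<^sup>2 * (x (j', k'))\<^sup>2 else 0)"
    unfolding sum.cartesian_product'
    by (intro sum.cong refl) (auto simp: B_def power_mult_distrib intro!: sum.cong)
  also have "\<dots> = real n * (\<Sum>j<n. \<Sum>j'<n. \<Sum>k<n. \<Sum>k'<n. (y (j, k))\<^sup>2 * (x (j', k'))\<^sup>2)"
    using L by simp
  also have "(\<Sum>j<n. \<Sum>j'<n. \<Sum>k<n. \<Sum>k'<n. (y (j, k))\<^sup>2 * (x (j', k'))\<^sup>2)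
      = (\<Sum>j<n. \<Sum>k<n. \<Sum>j'<n. \<Sum>k'<n. (y (j, k))\<^sup>2 * (x (j', k'))\<^sup>2)"
    by (rule sum.cong[OF refl], rule sum.swap)
  also have "\<dots> = (vnorm (square_index n) y)\<^sup>2 * (vnorm (square_index n) x)\<^sup>2"
    unfolding vnorm_power2 sum.cartesian_product' by (simp flip: sum_distrib_left sum_distrib_right)
  also have "real n * \<dots> \<le> real n * (1 * 1)"
    using x y by (intro mult_left_mono mult_mono) (auto simp: power_le_one)
  finally have fr: "(\<Sum>a\<in>L \<times> square_index n. \<Sum>b\<in>L \<times> square_index n. (B a b)\<^sup>2) \<le> real n" by simp
  have "measure G {A \<in> space G. bil (square_index n) (square_index n) (centered_kron_sum L n A) y x \<ge> 2 * sqrt n}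
      \<le> 2 * (\<Sum>a\<in>L \<times> square_index n. \<Sum>b\<in>L \<times> square_index n. (B a b)\<^sup>2) / (2 * sqrt n)\<^sup>2"
    unfolding bil_centered_kron_sum_eq_chaos[OF L] B_def[symmetric] G_def gauss_slices_def
    using L n by (intro std_normal_chaos_tail) auto
  also have "\<dots> \<le> 2 * real n / (2 * sqrt n)\<^sup>2"
    using fr by (intro divide_right_mono) auto
  also have "\<dots> = 1/2" using n by (simp add: power_mult_distrib)
  finally show ?thesis .
qed

lemma measurable_bil_centered_kron_sum:
  "(\<lambda>A. bil (square_index n) (square_index n) (centered_kron_sum L n A) y x) \<in> borel_measurable (gauss_slices L n)"
  unfolding centered_kron_sum_def slice_kron_sum_def
  by (intro measurable_bil borel_measurable_diff borel_measurable_sum borel_measurable_const measurable_kron_slice)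

text \<open>Both copies are centered by the same n w w^T, which cancels in the difference.\<close>

lemma merge_slices_diff:
  assumes "p \<in> square_index n" "q \<in> square_index n"
  shows "(\<Sum>i<n. slice_pair_diff n (merge ({..<n} \<times> square_index n) ({n..<2 * n} \<times> square_index n) (A, A')) i p q)
    = centered_kron_sum {..<n} n A p q - centered_kron_sum {n..<2 * n} n A' p q"
proof -
  have "(\<Sum>i\<in>{n..<2 * n}. kron (slice A' i) (slice A' i) p q) = (\<Sum>i<n. kron (slice A' (n + i)) (slice A' (n + i)) p q)"
    by (rule sum.reindex_bij_witness[of _ "\<lambda>i. n + i" "\<lambda>i. i - n"]) auto
  then show ?thesis
    using assms by (cases p; cases q)
      (simp add: centered_kron_sum_def slice_kron_sum_def slice_pair_diff_def kron_def slice_def merge_def sum_subtractf)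
qed

text \<open>The net makes the large-norm event a finite union and hence measurable; its cardinality
  does not enter the bound. The trace tail applies after merging the two copies into one tensor with
  2n slices.\<close>

lemma centered_kron_sum_net_tail:
  fixes n m :: nat
  assumes n: "n > 0" and t: "t > 0"
  defines "G \<equiv> gauss_slices {..<n} n" and "D \<equiv> square_index n" and "p \<equiv> 2 ^ Suc m"
  shows "measure G {A \<in> space G. \<exists>y\<in>lattice_net D. \<exists>x\<in>lattice_net D.
        bil D D (centered_kron_sum {..<n} n A) y x \<ge> t + 2 * sqrt n}
    \<le> 2 * (2 * real n * exp (- 7 * real n) + 2 * (real n)\<^sup>2 * (2 * exp 1 * real p * (2 ^ 18 * real n ^ 3)) ^ p / t ^ (2 * p))"
proof -
  define N' where "N' = gauss_slices {n..<2 * n} n"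
  define Q where "Q = gauss_slices {..<2 * n} n"
  define I where "I = {..<n} \<times> square_index n"
  define J where "J = {n..<2 * n} \<times> square_index n"
  define Ev where "Ev = {A \<in> space Q. pair_diff_trace n p A \<ge> t ^ (2 * p)}"
  define E where "E = merge I J -` Ev \<inter> space (G \<Otimes>\<^sub>M N')"
  define B where "B = {A \<in> space G. \<exists>y\<in>lattice_net D. \<exists>x\<in>lattice_net D.
        bil D D (centered_kron_sum {..<n} n A) y x \<ge> t + 2 * sqrt n}"
  interpret G: prob_space G unfolding G_def by (rule prob_space_gauss_slices)
  interpret N': prob_space N' unfolding N'_def by (rule prob_space_gauss_slices)
  interpret std: product_prob_space "\<lambda>_::nat \<times> nat \<times> nat. std_normal_distribution"
    by (rule product_prob_space_std_normal)
  have IJ: "I \<inter> J = {}" "I \<union> J = {..<2 * n} \<times> square_index n" "finite I" "finite J"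
    by (auto simp: I_def J_def)
  have QIJ: "Q = PiM (I \<union> J) (\<lambda>_. std_normal_distribution)"
    by (simp add: Q_def gauss_slices_def IJ)
  have merge_meas: "merge I J \<in> measurable (G \<Otimes>\<^sub>M N') Q"
    unfolding QIJ G_def N'_def gauss_slices_def I_def J_def by (rule measurable_merge)
  have distr: "distr (G \<Otimes>\<^sub>M N') Q (merge I J) = Q"
    using std.distr_merge[OF IJ(1,3,4)] unfolding QIJ
    by (simp add: G_def N'_def gauss_slices_def I_def J_def)
  have Ev: "Ev \<in> sets Q"
    unfolding Ev_def using measurable_pair_diff_trace[of n p, folded Q_def] by measurable
  have E: "E \<in> sets (G \<Otimes>\<^sub>M N')" unfolding E_def using merge_meas Ev by (rule measurable_sets)
  have [measurable]: "(\<lambda>A. bil D D (centered_kron_sum {..<n} n A) y x) \<in> borel_measurable G" for y x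
    unfolding G_def D_def by (rule measurable_bil_centered_kron_sum)
  have [measurable]: "(\<lambda>A. bil D D (centered_kron_sum {n..<2 * n} n A) y x) \<in> borel_measurable N'" for y x
    unfolding N'_def D_def by (rule measurable_bil_centered_kron_sum)
  have finD: "finite D" by (simp add: D_def)
  have B: "B \<in> sets G"
    unfolding B_def by (intro sets.sets_Collect_finite_Ex finite_lattice_net finD) measurable
  \<comment> \<open>The witnesses y and x depend on A but not on the independent copy, so for that
    copy they are a fixed pair and the estimate at level 2 sqrt n applies.\<close>
  have half: "measure N' (Pair A -` E) \<ge> 1/2" if A: "A \<in> B" for A
  proof -
    obtain y x where y: "y \<in> lattice_net D" and x: "x \<in> lattice_net D" and AG: "A \<in> space G"
      and large: "bil D D (centered_kron_sum {..<n} n A) y x \<ge> t + 2 * sqrt n"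
      using A by (auto simp: B_def)
    have y1: "vnorm D y \<le> 1" and x1: "vnorm D x \<le> 1"
      using x y by (simp_all add: vnorm_lattice_net_le)
    define W where "W = {A' \<in> space N'. bil D D (centered_kron_sum {n..<2 * n} n A') y x \<ge> 2 * sqrt n}"
    have W: "W \<in> sets N'" unfolding W_def by measurable
    have "measure N' W \<le> 1/2"
      unfolding W_def N'_def D_def
      by (rule bil_centered_kron_sum_tail) (use n x1 y1 in \<open>auto simp: D_def\<close>)
    then have "1/2 \<le> measure N' (space N' - W)" using W by (simp add: N'.prob_compl)
    also have "\<dots> \<le> measure N' (Pair A -` E)"
    proof (rule N'.finite_measure_mono)
      show "Pair A -` E \<in> sets N'" using E by (rule sets_Pair1)
      show "space N' - W \<subseteq> Pair A -` E"
      proof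
        fix A' assume A': "A' \<in> space N' - W"
        define X where "X = (\<lambda>a b. \<Sum>i<n. slice_pair_diff n (merge I J (A, A')) i a b)"
        have "bil D D X y x = bil D D (\<lambda>a b. centered_kron_sum {..<n} n A a b + (- 1) * centered_kron_sum {n..<2 * n} n A' a b) y x"
          by (rule bil_cong) (simp add: X_def I_def J_def D_def merge_slices_diff)
        also have "\<dots> = bil D D (centered_kron_sum {..<n} n A) y x - bil D D (centered_kron_sum {n..<2 * n} n A') y x"
          unfolding bil_add_mat bil_scale_mat by simp
        moreover have "bil D D (centered_kron_sum {n..<2 * n} n A') y x < 2 * sqrt n"
          using A' by (auto simp: W_def)
        ultimately have "t \<le> bil D D X y x" using large by linarith
        then have "t ^ (2 * p) \<le> gram_trace D D X p"
          unfolding p_def using t by (intro bil_power_le_gram_trace[OF finD y1 x1]) auto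
        then have "merge I J (A, A') \<in> Ev"
          using measurable_space[OF merge_meas, of "(A, A')"] AG A'
          by (simp add: Ev_def pair_diff_trace_def X_def D_def space_pair_measure)
        then show "A' \<in> Pair A -` E" using AG A' by (simp add: E_def space_pair_measure)
      qed
    qed
    finally show ?thesis .
  qed
  have "measure G B \<le> 2 * measure (G \<Otimes>\<^sub>M N') E"
    by (rule measure_pair_ge_half[OF G.prob_space_axioms N'.prob_space_axioms E B half])
  also have "measure (G \<Otimes>\<^sub>M N') E = measure Q Ev"
    using measure_distr[OF merge_meas Ev] unfolding distr E_def by simp
  also have "\<dots> \<le> 2 * real n * exp (- 7 * real n)
      + 2 * (real n)\<^sup>2 * (2 * exp 1 * real p * (2 ^ 18 * real n ^ 3)) ^ p / t ^ (2 * p)"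
    unfolding Ev_def Q_def p_def using n t by (intro pair_diff_trace_tail) auto
  finally show ?thesis by (simp add: B_def)
qed

section \<open>Recovery of the spike\<close>

lemma spectral_mat_spiked_eq:
  fixes A :: "nat \<times> nat \<times> nat \<Rightarrow> real" and v0 :: "nat \<Rightarrow> real"
  assumes v0: "vnorm {..<n} v0 = 1" and p: "p \<in> square_index n" and q: "q \<in> square_index n"
  defines "P \<equiv> \<lambda>j k. v0 j * v0 k" and "G \<equiv> slice_comb {..<n} v0 A"
  shows "spectral_mat n (spiked \<tau> v0 A) p q
    = \<tau>\<^sup>2 * (v0 (fst p) * v0 (snd p)) * (v0 (fst q) * v0 (snd q))
      + (\<tau> * (kron P G p q + kron G P p q) + centered_kron_sum {..<n} n A p q)"
proof -
  have vv: "(\<Sum>i<n. (v0 i)\<^sup>2) = 1" using v0 vnorm_power2[of "{..<n}" v0] by simp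
  obtain j k j' k' where pq: "p = (j, k)" "q = (j', k')" by (cases p; cases q)
  have "(\<Sum>i<n. kron (slice (spiked \<tau> v0 A) i) (slice (spiked \<tau> v0 A) i) p q)
      = (\<Sum>i<n. \<tau>\<^sup>2 * (v0 j * v0 k) * (v0 j' * v0 k') * (v0 i)\<^sup>2
          + \<tau> * (v0 j * v0 j') * (v0 i * A (i, k, k'))
          + \<tau> * (v0 k * v0 k') * (v0 i * A (i, j, j'))
          + A (i, j, j') * A (i, k, k'))"
    by (intro sum.cong refl) (simp add: pq kron_def slice_def spiked_def power2_eq_square algebra_simps)
  also have "\<dots> = \<tau>\<^sup>2 * (v0 j * v0 k) * (v0 j' * v0 k') * (\<Sum>i<n. (v0 i)\<^sup>2)
      + \<tau> * (v0 j * v0 j') * (\<Sum>i<n. v0 i * A (i, k, k'))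
      + \<tau> * (v0 k * v0 k') * (\<Sum>i<n. v0 i * A (i, j, j'))
      + (\<Sum>i<n. A (i, j, j') * A (i, k, k'))"
    by (simp only: sum.distrib sum_distrib_left)
  finally show ?thesis
    unfolding vv
    by (simp add: spectral_mat_def centered_kron_sum_def slice_kron_sum_def pq kron_def slice_def P_def G_def
        slice_comb_def algebra_simps)
qed

lemma spiked_recovery:
  assumes v0: "vnorm {..<n} v0 = 1" and \<tau>: "\<tau> > 0"
    and g: "op_bound {..<n} {..<n} (slice_comb {..<n} v0 A) g"
    and h: "op_bound (square_index n) (square_index n) (centered_kron_sum {..<n} n A) h"
    and \<eta>: "2 * \<tau> * g + h \<le> \<eta> * \<tau>\<^sup>2" "0 \<le> \<eta>" "\<eta> \<le> 1/16"
    and v': "top_sv (square_index n) (spectral_mat n (spiked \<tau> v0 A)) v'"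
    and v: "top_sv {..<n} (fold_vec v') v"
  shows "(\<Sum>i<n. v i * v0 i)\<^sup>2 \<ge> 1 - 256 * \<eta>"
proof -
  define D where "D = square_index n"
  define P where "P = (\<lambda>j k. v0 j * v0 k)"
  define G where "G = slice_comb {..<n} v0 A"
  define u where "u = (\<lambda>p. v0 (fst p) * v0 (snd p))"
  define E where "E = (\<lambda>p q. \<tau> * (kron P G p q + kron G P p q) + centered_kron_sum {..<n} n A p q)"
  have vv: "(\<Sum>i<n. (v0 i)\<^sup>2) = 1" using v0 vnorm_power2[of "{..<n}" v0] by simp
  have PP: "(\<Sum>j<n. \<Sum>k<n. (P j k)\<^sup>2) = 1"
    by (simp add: P_def power_mult_distrib vv flip: sum_distrib_left)
  then have P1: "op_bound {..<n} {..<n} P 1"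
    using op_bound_frobenius[of "{..<n}" "{..<n}" P] by simp
  have "(vnorm D u)\<^sup>2 = 1"
    using PP unfolding vnorm_power2 D_def sum.cartesian_product' by (simp add: u_def P_def)
  then have u: "vnorm D u = 1" using vnorm_nonneg[of D u] by (simp add: power2_eq_1_iff)
  \<comment> \<open>P has Frobenius norm 1, so each Kronecker product of P and G inherits the bound
    g.\<close>
  have "op_bound D D E (\<bar>\<tau>\<bar> * (1 * g + g * 1) + h)"
    unfolding E_def D_def using g h P1
    by (intro op_bound_add op_bound_scale op_bound_kron) (auto simp: G_def)
  then have E: "op_bound D D E (\<eta> * \<tau>\<^sup>2)"
    by (rule op_bound_mono) (use \<eta> \<tau> in \<open>simp add: algebra_simps\<close>)
  have M: "spectral_mat n (spiked \<tau> v0 A) p q = \<tau>\<^sup>2 * u p * u q + E p q" if "p \<in> D" "q \<in> D" for p q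
    using spectral_mat_spiked_eq[OF v0, of p q \<tau> A] that by (simp add: D_def u_def E_def P_def G_def)
  have near: "\<bar>\<Sum>p\<in>D. v' p * u p\<bar> \<ge> 1 - 2 * \<eta>"
    by (rule top_sv_rank_one[OF E _ u M v'[folded D_def]]) (use \<tau> in auto)
  have "vnorm (square_index n) v' = 1"
    using v' unfolding top_sv_def top_left_sv_def top_right_sv_def by blast
  then show ?thesis
    using top_sv_fold_aligned[OF v0 _ near[unfolded D_def u_def] \<eta>(2,3) v] by blast
qed

text \<open>Supplies an even power of two as the moment order, within a factor 2 of log n.\<close>

lemma exists_power_two_near:
  assumes "1 \<le> (x::real)"
  shows "\<exists>m. x \<le> 2 ^ Suc m \<and> 2 ^ Suc m \<le> 2 * x"
proof -
  obtain k where k: "x < 2 ^ k" using real_arch_pow[of 2 x] by auto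
  define k0 where "k0 = (LEAST k. x \<le> 2 ^ k)"
  have "\<exists>k. x \<le> 2 ^ k" using k less_imp_le by blast
  then have k0: "x \<le> 2 ^ k0" unfolding k0_def by (rule LeastI_ex)
  show ?thesis
  proof (cases k0)
    case 0
    \<comment> \<open>Here x = 1, and the admissible exponent starts at 1: the witness gives 2 = 2
      x.\<close>
    then show ?thesis using k0 assms by (intro exI[of _ 0]) simp
  next
    case (Suc m)
    then have "\<not> x \<le> 2 ^ m" unfolding k0_def using not_less_Least[of m "\<lambda>k. x \<le> 2 ^ k"] by simp
    then show ?thesis using k0 Suc by (intro exI[of _ m]) simp
  qed
qed

text \<open>The eleventh term of the exponential series: one power absorbs the factor n from the
  union over slices, ten remain for the failure probability.\<close>

lemma exp_minus_le_power:
  fixes n :: nat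
  assumes "n > 0"
  shows "real n * exp (- 7 * real n) \<le> fact 11 * real n powr (- 10)"
proof -
  have "real n ^ 11 / fact 11 \<le> exp (real n)"
  proof -
    have "(\<Sum>k\<in>{11::nat}. real n ^ k /\<^sub>R fact k) \<le> (\<Sum>k. real n ^ k /\<^sub>R fact k)"
      by (intro sum_le_suminf summable_exp_generic) auto
    then show ?thesis by (simp add: exp_def divide_inverse mult.commute)
  qed
  then have "real n * real n ^ 10 \<le> fact 11 * exp (real n)" by (simp add: field_simps flip: power_Suc)
  also have "\<dots> \<le> fact 11 * exp (7 * real n)" by simp
  finally have "real n * real n ^ 10 * exp (- 7 * real n) \<le> fact 11 * (exp (7 * real n) * exp (- 7 * real n))"
    by (simp add: mult_right_mono mult.assoc[symmetric])
  then have "real n * real n ^ 10 * exp (- 7 * real n) \<le> fact 11" by (simp flip: exp_add)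
  then show ?thesis using assms by (simp add: powr_minus powr_numeral field_simps)
qed

text \<open>The moment order p lies between log n and 2 log n: the lower bound makes exp(-12 p)
  polynomially small, the upper bound keeps the level t at the order of (n^3 log n)^(1/2). The
  hypothesis 3 \<le> n ensures log n \<ge> 1.\<close>

lemma centered_kron_sum_op_tail:
  fixes n :: nat
  assumes n: "3 \<le> n"
  defines "G \<equiv> gauss_slices {..<n} n" and "D \<equiv> square_index n"
  shows "\<exists>t. 0 < t \<and> t \<le> (sqrt (exp 13 * 2 ^ 20) + 2) * sqrt (real n ^ 3 * ln (real n)) \<and>
    measure G {A \<in> space G. \<exists>y\<in>lattice_net D. \<exists>x\<in>lattice_net D.
        bil D D (centered_kron_sum {..<n} n A) y x \<ge> t} \<le> (4 * fact 11 + 4) * real n powr (- 10)"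
proof -
  have ln1: "1 \<le> ln (real n)"
  proof -
    have "exp 1 \<le> real n" using exp_le n by linarith
    then show ?thesis using n by (simp add: ln_ge_iff)
  qed
  obtain m where m: "ln (real n) \<le> 2 ^ Suc m" "2 ^ Suc m \<le> 2 * ln (real n)"
    using exists_power_two_near[OF ln1] by blast
  define p :: nat where "p = 2 ^ Suc m"
  have p: "ln (real n) \<le> real p" "real p \<le> 2 * ln (real n)" using m by (simp_all add: p_def)
  define b where "b = 2 * exp 1 * real p * (2 ^ 18 * real n ^ 3)"
  have b: "b > 0" using n by (simp add: b_def p_def)
  \<comment> \<open>With t^2 = e^12 b the moment ratio is (b / t^2)^p = e^(-12 p) \<le> n^(-12); the
    dimension factor n^2 turns this into n^(-10).\<close>
  define t where "t = sqrt (exp 12 * b)"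
  have t: "t > 0" using b by (simp add: t_def)
  have t2p: "t ^ (2 * p) = exp 12 ^ p * b ^ p"
    using b by (simp add: t_def power_mult power_mult_distrib)
  have n10: "2 * (real n)\<^sup>2 * b ^ p / t ^ (2 * p) \<le> 2 * real n powr (- 10)"
  proof -
    have "2 * (real n)\<^sup>2 * b ^ p / t ^ (2 * p) = 2 * (real n)\<^sup>2 * exp (- 12 * real p)"
      unfolding t2p using b by (simp add: exp_minus field_simps flip: exp_of_nat_mult)
    also have "\<dots> \<le> 2 * (real n)\<^sup>2 * exp (- 12 * ln (real n))"
      using p by (intro mult_left_mono) auto
    also have "exp (- 12 * ln (real n)) = real n powr (- 12)" using n by (simp add: powr_def)
    also have "2 * (real n)\<^sup>2 * real n powr (- 12) = 2 * real n powr (- 10)"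
    proof -
      have "(real n)\<^sup>2 = real n powr 2" using n by (simp add: powr_numeral)
      then have "(real n)\<^sup>2 * real n powr (- 12) = real n powr (2 + - 12)" by (simp only: powr_add)
      then show ?thesis by simp
    qed
    finally show ?thesis .
  qed
  have s: "sqrt (real n) \<le> sqrt (real n ^ 3 * ln (real n))"
  proof -
    have "real n * 1 \<le> real n ^ 3 * ln (real n)"
      using n ln1 self_le_power[of "real n" 3] by (intro mult_mono) auto
    then show ?thesis by simp
  qed
  have "exp 12 * b \<le> exp 12 * (2 * exp 1 * (2 * ln (real n)) * (2 ^ 18 * real n ^ 3))"
    unfolding b_def using p by (intro mult_left_mono mult_right_mono) auto
  also have "\<dots> = exp (12 + 1) * 2 ^ 20 * (real n ^ 3 * ln (real n))" unfolding exp_add by simp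
  finally have "t \<le> sqrt (exp 13 * 2 ^ 20 * (real n ^ 3 * ln (real n)))" by (simp add: t_def)
  then have "t \<le> sqrt (exp 13 * 2 ^ 20) * sqrt (real n ^ 3 * ln (real n))" by (simp only: real_sqrt_mult)
  then have le: "t + 2 * sqrt n \<le> (sqrt (exp 13 * 2 ^ 20) + 2) * sqrt (real n ^ 3 * ln (real n))"
    unfolding distrib_right using s by linarith
  have "measure G {A \<in> space G. \<exists>y\<in>lattice_net D. \<exists>x\<in>lattice_net D.
        bil D D (centered_kron_sum {..<n} n A) y x \<ge> t + 2 * sqrt n}
      \<le> 2 * (2 * real n * exp (- 7 * real n) + 2 * (real n)\<^sup>2 * b ^ p / t ^ (2 * p))"
    unfolding G_def D_def b_def p_def using n t by (intro centered_kron_sum_net_tail) auto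
  also have "\<dots> \<le> 2 * (2 * (fact 11 * real n powr (- 10)) + 2 * real n powr (- 10))"
    using n10 exp_minus_le_power[of n] n by simp
  also have "\<dots> = (4 * fact 11 + 4) * real n powr (- 10)" by (simp add: algebra_simps)
  finally have tail: "measure G {A \<in> space G. \<exists>y\<in>lattice_net D. \<exists>x\<in>lattice_net D.
        bil D D (centered_kron_sum {..<n} n A) y x \<ge> t + 2 * sqrt n} \<le> (4 * fact 11 + 4) * real n powr (- 10)" .
  have "0 < t + 2 * sqrt n" using t by (intro add_pos_nonneg) auto
  then show ?thesis using le tail by blast
qed

theorem mainTheorem8:
  "\<exists>C K1 K2 :: real. \<forall>(n::nat) (v0::nat \<Rightarrow> real) (\<epsilon>::real) (\<tau>::real).
     n \<ge> 1 \<longrightarrow> vnorm {..<n} v0 = 1 \<longrightarrow> \<epsilon> > 0 \<longrightarrow>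
     \<tau> \<ge> C * real n powr (3/4) * ln (real n) powr (1/4) / \<epsilon> \<longrightarrow>
     (\<exists>E \<in> sets (gauss_tensor n).
        measure (gauss_tensor n) E \<ge> 1 - K1 * real n powr (-10) \<and>
        (\<forall>A \<in> E. \<forall>v' v.
           top_sv ({..<n} \<times> {..<n}) (spectral_mat n (spiked \<tau> v0 A)) v' \<longrightarrow>
           top_sv {..<n} (fold_vec v') v \<longrightarrow>
           (\<Sum>i<n. v i * v0 i)\<^sup>2 \<ge> 1 - K2 * \<epsilon>))"
proof -
  define \<kappa> where "\<kappa> = sqrt (exp 13 * 2 ^ 20) + (2::real)"
  have \<kappa>: "\<kappa> \<ge> 0" by (simp add: \<kappa>_def)
  \<comment> \<open>One \<open>fact 11\<close> comes from the bound on G, the rest from N. The total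
    also exceeds 2^10, which settles n < 3.\<close>
  define K1 :: real where "K1 = 5 * fact 11 + 4"
  \<comment> \<open>Recovery loses 256 \<eta> with \<eta> = (32 + 2 \<kappa>) \<epsilon>, where 32
    pays for the cross term and 2 \<kappa> for N. Since K2 absorbs every constant, C = 1 is a valid
    witness.\<close>
  define K2 where "K2 = 256 * (32 + 2 * \<kappa>)"
  show ?thesis
  proof (rule exI[of _ 1], rule exI[of _ K1], rule exI[of _ K2], intro allI impI)
    fix n :: nat and v0 :: "nat \<Rightarrow> real" and \<epsilon> \<tau> :: real
    assume n1: "n \<ge> 1" and v0: "vnorm {..<n} v0 = 1" and \<epsilon>: "\<epsilon> > 0"
      and \<tau>: "\<tau> \<ge> 1 * real n powr (3/4) * ln (real n) powr (1/4) / \<epsilon>"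
    show "\<exists>E \<in> sets (gauss_tensor n).
        measure (gauss_tensor n) E \<ge> 1 - K1 * real n powr (-10) \<and>
        (\<forall>A \<in> E. \<forall>v' v.
           top_sv ({..<n} \<times> {..<n}) (spectral_mat n (spiked \<tau> v0 A)) v' \<longrightarrow>
           top_sv {..<n} (fold_vec v') v \<longrightarrow>
           (\<Sum>i<n. v i * v0 i)\<^sup>2 \<ge> 1 - K2 * \<epsilon>)"
    proof (cases "n \<ge> 3")
      case False
      \<comment> \<open>For n < 3 the required probability is at most 0, so the empty event
        serves.\<close>
      have "real n ^ 10 \<le> 2 ^ 10" using False by (intro power_mono) auto
      also have "\<dots> \<le> K1" by (simp add: K1_def fact_numeral)
      finally have "1 \<le> K1 * real n powr (-10)"
        using n1 by (simp add: powr_minus powr_numeral field_simps)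
      then show ?thesis by (intro bexI[of _ "{}"]) auto
    next
      case n: True
      define D where "D = square_index n"
      obtain t where t: "0 < t" "t \<le> \<kappa> * sqrt (real n ^ 3 * ln (real n))"
        and t_tail: "measure (gauss_slices {..<n} n) {A \<in> space (gauss_slices {..<n} n). \<exists>y\<in>lattice_net D. \<exists>x\<in>lattice_net D.
          bil D D (centered_kron_sum {..<n} n A) y x \<ge> t} \<le> (4 * fact 11 + 4) * real n powr (- 10)"
        using centered_kron_sum_op_tail[OF n] unfolding D_def \<kappa>_def by blast
      define N where "N = gauss_slices {..<n} n"
      interpret prob_space N unfolding N_def by (rule prob_space_gauss_slices)
      define B1 where "B1 = {A \<in> space N. \<exists>y\<in>lattice_net {..<n}. \<exists>x\<in>lattice_net {..<n}.
        bil {..<n} {..<n} (slice_comb {..<n} v0 A) y x \<ge> 8 * sqrt n}"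
      define B2 where "B2 = {A \<in> space N. \<exists>y\<in>lattice_net D. \<exists>x\<in>lattice_net D.
        bil D D (centered_kron_sum {..<n} n A) y x \<ge> t}"
      have [measurable]: "(\<lambda>A. bil {..<n} {..<n} (slice_comb {..<n} v0 A) y x) \<in> borel_measurable N" for y x
        unfolding slice_comb_def slice_def N_def
        by (intro measurable_bil borel_measurable_sum borel_measurable_times borel_measurable_const
            measurable_gauss_slices_component) auto
      have [measurable]: "(\<lambda>A. bil D D (centered_kron_sum {..<n} n A) y x) \<in> borel_measurable N" for y x
        unfolding N_def D_def by (rule measurable_bil_centered_kron_sum)
      have B1: "B1 \<in> sets N"
        unfolding B1_def by (intro sets.sets_Collect_finite_Ex finite_lattice_net finite_lessThan) measurable
      have finD: "finite D" by (simp add: D_def)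
      have B2: "B2 \<in> sets N"
        unfolding B2_def by (intro sets.sets_Collect_finite_Ex finite_lattice_net finD) measurable
      have vv: "(\<Sum>i<n. (v0 i)\<^sup>2) \<le> 1" using v0 vnorm_power2[of "{..<n}" v0] by simp
      have "measure N B1 \<le> exp (- 7 * real n)"
        unfolding B1_def N_def by (rule slice_comb_tail[OF finite_lessThan vv])
      also have "\<dots> \<le> real n * exp (- 7 * real n)" using n by simp
      also have "\<dots> \<le> fact 11 * real n powr (- 10)" using n by (intro exp_minus_le_power) simp
      finally have "measure N B1 \<le> fact 11 * real n powr (- 10)" .
      moreover have "measure N B2 \<le> (4 * fact 11 + 4) * real n powr (- 10)"
        unfolding B2_def N_def by (rule t_tail)
      moreover have "measure N (B1 \<union> B2) \<le> measure N B1 + measure N B2"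
        using B1 B2 by (intro measure_Un_le) auto
      ultimately have "measure N (B1 \<union> B2) \<le> K1 * real n powr (- 10)"
        by (simp add: K1_def algebra_simps)
      then have prob: "measure N (space N - (B1 \<union> B2)) \<ge> 1 - K1 * real n powr (- 10)"
        using B1 B2 by (simp add: prob_compl)
      define a where "a = real n powr (3/4) * ln (real n) powr (1/4)"
      have ln1: "1 \<le> ln (real n)"
      proof -
        have "exp 1 \<le> real n" using exp_le n by linarith
        then show ?thesis using n by (simp add: ln_ge_iff)
      qed
      have a: "a > 0" using n ln1 by (simp add: a_def)
      have a4: "a ^ 4 = real n ^ 3 * ln (real n)"
        using n ln1 by (simp add: a_def power_mult_distrib powr_power powr_numeral)
      have a2: "a\<^sup>2 = sqrt (real n ^ 3 * ln (real n))"
        using a by (intro real_sqrt_unique[symmetric]) (simp_all add: a4[symmetric])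
      have sqrt_n: "sqrt n \<le> a"
      proof -
        have "(real n)\<^sup>2 * 1 \<le> real n ^ 3 * ln (real n)"
          using n ln1 by (intro mult_mono power_increasing) auto
        then have "(real n)\<^sup>2 \<le> (a\<^sup>2)\<^sup>2" by (simp add: a4[symmetric])
        then have "real n \<le> a\<^sup>2" by (rule power2_le_imp_le) simp
        then show ?thesis using a by (intro real_le_lsqrt) auto
      qed
      have at: "a \<le> \<tau> * \<epsilon>" using \<tau> \<epsilon> by (simp add: a_def pos_divide_le_eq)
      then have \<tau>0: "\<tau> > 0" using a \<epsilon> by (metis less_le_trans zero_less_mult_pos2)
      have "(\<Sum>i<n. v i * v0 i)\<^sup>2 \<ge> 1 - K2 * \<epsilon>"
        if A: "A \<in> space N - (B1 \<union> B2)"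
          and v': "top_sv ({..<n} \<times> {..<n}) (spectral_mat n (spiked \<tau> v0 A)) v'"
          and v: "top_sv {..<n} (fold_vec v') v" for A v' v
      proof (cases "(32 + 2 * \<kappa>) * \<epsilon> \<le> 1/16")
        case False
        \<comment> \<open>Large \<epsilon> makes the claimed lower bound negative, since 256 / 16 >
          1. The other case supplies the smallness that the perturbation argument requires.\<close>
        then have "1 - K2 * \<epsilon> \<le> 0" unfolding K2_def mult.assoc by linarith
        also have "0 \<le> (\<Sum>i<n. v i * v0 i)\<^sup>2" by simp
        finally show ?thesis .
      next
        case True
        have "32 * \<epsilon> \<le> (32 + 2 * \<kappa>) * \<epsilon>" using \<kappa> \<epsilon> by (intro mult_right_mono) auto
        \<comment> \<open>The estimate a \<le> \<tau> \<epsilon> gives a^2 \<le> \<epsilon>^2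
          \<tau>^2; \<epsilon> \<le> 1 weakens this to \<epsilon> \<tau>^2, so the bound for N has
          the same linear form in \<epsilon> as the one for the cross term.\<close>
        then have \<epsilon>1: "\<epsilon> \<le> 1" using True by linarith
        have g: "op_bound {..<n} {..<n} (slice_comb {..<n} v0 A) (2 * (8 * sqrt n))"
          using A by (intro op_bound_lattice_net) (auto simp: B1_def not_le intro: less_imp_le)
        have h: "op_bound D D (centered_kron_sum {..<n} n A) (2 * t)"
          using A t(1) by (intro op_bound_lattice_net finD) (auto simp: B2_def not_le intro: less_imp_le)
        have "sqrt n \<le> \<tau> * \<epsilon>" using sqrt_n at by linarith
        then have "2 * \<tau> * (2 * (8 * sqrt n)) \<le> 2 * \<tau> * (2 * (8 * (\<tau> * \<epsilon>)))"
          using \<tau>0 by (intro mult_left_mono) auto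
        moreover have "2 * t \<le> 2 * \<kappa> * (\<epsilon> * \<tau>\<^sup>2)"
        proof -
          have "a\<^sup>2 \<le> (\<tau> * \<epsilon>)\<^sup>2" using at a by (intro power_mono) auto
          also have "\<dots> = \<epsilon> * (\<epsilon> * \<tau>\<^sup>2)" by (simp add: power2_eq_square)
          also have "\<dots> \<le> 1 * (\<epsilon> * \<tau>\<^sup>2)" using \<epsilon> \<epsilon>1 by (intro mult_right_mono) auto
          finally have "\<kappa> * a\<^sup>2 \<le> \<kappa> * (\<epsilon> * \<tau>\<^sup>2)" using \<kappa> by (intro mult_left_mono) auto
          then show ?thesis using t(2) by (simp add: a2)
        qed
        ultimately have "2 * \<tau> * (2 * (8 * sqrt n)) + 2 * t \<le> ((32 + 2 * \<kappa>) * \<epsilon>) * \<tau>\<^sup>2"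
          by (simp add: power2_eq_square algebra_simps)
        moreover have "0 \<le> (32 + 2 * \<kappa>) * \<epsilon>" using \<kappa> \<epsilon> by simp
        ultimately show ?thesis
          using spiked_recovery[OF v0 \<tau>0 g h[unfolded D_def] _ _ True v' v]
          unfolding K2_def mult.assoc by blast
      qed
      moreover have "space N - (B1 \<union> B2) \<in> sets (gauss_tensor n)"
        using B1 B2 by (auto simp: gauss_tensor_eq N_def)
      ultimately show ?thesis
        using prob unfolding gauss_tensor_eq N_def[symmetric]
        by (intro bexI[of _ "space N - (B1 \<union> B2)"]) blast+
    qed
  qed
qed

end
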